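(* $$\sup_{F\in\mathcal V_3^3}\Phi_{\mathrm{diag}}(F)=\sup_{f\in\mathcal L_{3,3}^+}\Phi_{\mathrm{diag}}(f)=8.$$
   Context: $\Delta_3^3=\{\alpha\in\mathbb Z_{\ge0}^3:\alpha_1+\alpha_2+\alpha_3=3\}$, $e_1,e_2,e_3$ is the standard basis of $\mathbb R^3$. Homogeneous cubics in three variables are written $f=\sum_{\alpha\in\Delta_3^3}c_\alpha x_1^{\alpha_1}x_2^{\alpha_2}x_3^{\alpha_3}/(\alpha_1!\alpha_2!\alpha_3!)$, and $c_{abc}=c_{(a,b,c)}$. $\mathcal L_{3,3}^+$ is the set of full-support Lorentzian cubics: those $f$ with all $c_\alpha>0$ such that for each $i\in\{1,2,3\}$ the symmetric matrix $(c_{e_i+e_j+e_k})_{1\le j,k\le3}$ has at most one positive eigenvalue. $\mathcal V_3^3$ is the set of full-support (all $c_\alpha>0$) volume polynomials $F_K(x_1,x_2,x_3)=\operatorname{Vol}(x_1K_1+x_2K_2+x_3K_3)$ ($x_i\ge0$, Minkowski sum, three-dimensional volume) of triples $K=(K_1,K_2,K_3)$ of convex bodies (nonempty compact convex sets) in $\mathbb R^3$. In this normalization $c_\alpha$ equals six times the mixed volume with $\alpha_i$ copies of $K_i$ for each $i$. For a cubic with all $c_\alpha>0$, $$\Phi_{\mathrm{diag}}(f)=\frac{c_{111}^3c_{300}c_{030}c_{003}}{c_{210}c_{201}c_{120}c_{021}c_{102}c_{012}}.$$ *)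

theory Defs
  imports "HOL-Analysis.Analysis" "Jordan_Normal_Form.Char_Poly"
begin

type_synonym expo = "nat \<times> nat \<times> nat"

definition Delta33 :: "expo set" where
  "Delta33 = {(a1, a2, a3). a1 + a2 + a3 = 3}"

text \<open>A homogeneous cubic in three variables is given by its normalized coefficients
  \<open>c (a1, a2, a3)\<close>; the values of \<open>c\<close> outside \<^const>\<open>Delta33\<close> play no role.\<close>

type_synonym cubic = "expo \<Rightarrow> real"

definition cubic_eval :: "cubic \<Rightarrow> real \<Rightarrow> real \<Rightarrow> real \<Rightarrow> real" where
  "cubic_eval c x1 x2 x3 =
     (\<Sum>(a1, a2, a3)\<in>Delta33.
        c (a1, a2, a3) * (x1 ^ a1 * x2 ^ a2 * x3 ^ a3) / (fact a1 * fact a2 * fact a3))"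

definition full_support :: "cubic \<Rightarrow> bool" where
  "full_support c \<longleftrightarrow> (\<forall>\<alpha>\<in>Delta33. 0 < c \<alpha>)"

text \<open>The exponents of the three variables, numbered from 0.\<close>

definition unit_expo :: "nat \<Rightarrow> expo" where
  "unit_expo i = [(1, 0, 0), (0, 1, 0), (0, 0, 1)] ! i"

text \<open>The Hessian matrix of the partial derivative of the cubic in direction \<open>i\<close>.\<close>

definition cubic_slice :: "cubic \<Rightarrow> nat \<Rightarrow> real mat" where
  "cubic_slice c i = Matrix.mat 3 3 (\<lambda>(j, k). c (unit_expo i + unit_expo j + unit_expo k))"

text \<open>Eigenvalues are counted with algebraic multiplicity, i.e. as roots of the
  characteristic polynomial.\<close>

definition num_pos_eigenvalues :: "real mat \<Rightarrow> nat" where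
  "num_pos_eigenvalues A = size {#t \<in># proots (char_poly A). 0 < t#}"

definition lorentzian_cubics :: "cubic set" where
  "lorentzian_cubics =
     {c. full_support c \<and> (\<forall>i<3. num_pos_eigenvalues (cubic_slice c i) \<le> 1)}"

definition convex_body :: "(real ^ 3) set \<Rightarrow> bool" where
  "convex_body K \<longleftrightarrow> K \<noteq> {} \<and> compact K \<and> convex K"

text \<open>The sum of sets is the Minkowski sum. A polynomial function on the nonnegative
  orthant determines its coefficients, so \<open>c\<close> is unique on \<^const>\<open>Delta33\<close> for given bodies.\<close>

definition is_volume_polynomial ::
    "cubic \<Rightarrow> (real ^ 3) set \<Rightarrow> (real ^ 3) set \<Rightarrow> (real ^ 3) set \<Rightarrow> bool" where
  "is_volume_polynomial c K1 K2 K3 \<longleftrightarrow>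
     (\<forall>x1\<ge>0. \<forall>x2\<ge>0. \<forall>x3\<ge>0.
        cubic_eval c x1 x2 x3 =
          measure lebesgue ((*\<^sub>R) x1 ` K1 + (*\<^sub>R) x2 ` K2 + (*\<^sub>R) x3 ` K3))"

definition volume_cubics :: "cubic set" where
  "volume_cubics =
     {c. full_support c \<and>
         (\<exists>K1 K2 K3. convex_body K1 \<and> convex_body K2 \<and> convex_body K3 \<and>
            is_volume_polynomial c K1 K2 K3)}"

definition Phi_diag :: "cubic \<Rightarrow> real" where
  "Phi_diag c =
     (c (1, 1, 1) ^ 3 * c (3, 0, 0) * c (0, 3, 0) * c (0, 0, 3)) /
     (c (2, 1, 0) * c (2, 0, 1) * c (1, 2, 0) * c (0, 2, 1) * c (1, 0, 2) * c (0, 1, 2))"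

end

theory Submission
  imports Defs
begin

text \<open>Both suprema are governed by one inequality. The quantity $\Phi_{\mathrm{diag}}$ is the product over the three
variables of a factor such as $c_{300} c_{111} / (c_{210} c_{201})$, and every such factor is at most 2.

For a Lorentzian cubic, write the slice as a symmetric matrix with first row $a, b, c$, diagonal
$a, d, f$ and remaining entry $e$. One positive eigenvalue forces $ad \le b^2$, $af \le c^2$ and a
nonnegative determinant, and the identity
$a \det = (b^2 - ad)(c^2 - af) - (ae - bc)^2$ then gives $|ae - bc| \le bc$
(\<open>sym3_corner_bound\<close>).

For a volume polynomial the factor bound comes from Minkowski's quadratic inequality
$V(K,K,K) V(K,P,P) \le V(K,K,P)^2$, applied to $K = K_1$ and the single body $P = u K_2 + v K_3$ with
$u = c_{201}$ and $v = c_{210}$: discarding the squares $u^2 c_{120}$ and $v^2 c_{102}$ on the left leaves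
$c_{300} c_{111} \le 2 c_{210} c_{201}$ (\<open>log_concave_corner_bound\<close>). Minkowski's inequality is the
second-order form of $|A| |B| \le |(A+B)/2|^2$ near $K$, and this follows from the
Prekopa--Leindler inequality, which is proved on the line from the one-dimensional Brunn--Minkowski
inequality and passes to products by Fubini (\<open>multiplicative_brunn_minkowski\<close>).

For sharpness, $ae$ can come close to $2bc$ only if $ad$ and $af$ are negligible against $b^2$ and $c^2$, so that
seen from any one of the bodies the other two must look like segments. For two orthogonal segments the
bound is an equality when the first body is a pyramid over a rectangle with sides parallel to them. All three
bodies have to be of this kind at once. This is achieved by three pyramids over
coordinate rectangles, whose extents in the coordinate directions are
$(1,1,1)$, $(1,\varepsilon,\varepsilon^2)$ and $(\varepsilon,1,\varepsilon^2)$, with apexes on the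
third, first and second axis. After rescaling to the size of any one of them, each of the
other two is dominated by a single direction parallel to a side of its base. Because the sections of these
pyramids are so simple, the Minkowski sum $aK_1 + bK_2 + cK_3$ is the region under an explicit
piecewise linear graph, which yields the volume polynomial exactly (\<open>emeasure_pyramid_sum\<close>). With
$q = 1 + \varepsilon + 2\varepsilon^2$ and $r = 1 + 3\varepsilon^2 + 2\varepsilon^3$ one finds
$\Phi_{\mathrm{diag}} = 8 r^3 / q^6$, which tends to 8. The same cubics are Lorentzian, by a direct
check of determinants and principal minors.\<close>

section \<open>The Prekopa--Leindler inequality for midpoints\<close>

text \<open>The cut points range over the set itself, so that a cut point can serve as one of the summands in the
one-dimensional Brunn--Minkowski inequality. If the supremum is not attained, initial segments
ending in a countable cofinal family exhaust the set; if it is attained, they may miss only the maximum,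
which is a null set.\<close>

lemma emeasure_lborel_eq_SUP_initial_segments:
  fixes A :: "real set"
  assumes A: "A \<in> sets borel" and ne: "A \<noteq> {}"
  shows "emeasure lborel A = (SUP a\<in>A. emeasure lborel (A \<inter> {..a}))"
proof (rule antisym)
  show "(SUP a\<in>A. emeasure lborel (A \<inter> {..a})) \<le> emeasure lborel A"
    using A by (intro SUP_least emeasure_mono) auto
  define Q where "Q = {q\<in>\<rat>. \<exists>a\<in>A. q \<le> a}"
  obtain a0 where a0: "a0 \<in> A" using ne by auto
  have "countable Q" unfolding Q_def by (rule countable_subset[OF _ countable_rat]) auto
  moreover have "Q \<noteq> {}"
  proof -
    obtain q where "q \<in> \<rat>" "q < a0" using Rats_dense_in_real[of "a0 - 1" a0] by auto
    thus ?thesis using a0 by (auto simp: Q_def intro!: exI[of _ q] bexI[of _ a0])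
  qed
  ultimately obtain q :: "nat \<Rightarrow> real" where q: "range q = Q"
    by (metis range_from_nat_into)
  define S where "S n = A \<inter> {..Max (q ` {..n})}" for n
  have qmem: "Max (q ` {..n}) \<in> Q" for n
  proof -
    have "Max (q ` {..n}) \<in> q ` {..n}" by (rule Max_in) auto
    also have "q ` {..n} \<subseteq> Q" unfolding q[symmetric] by blast
    finally show ?thesis .
  qed
  have inc: "incseq S"
    unfolding S_def incseq_def
  proof (intro allI impI Int_mono order_refl)
    fix m n :: nat assume "m \<le> n"
    hence "Max (q ` {..m}) \<le> Max (q ` {..n})" by (intro Max_mono) auto
    thus "{..Max (q ` {..m})} \<subseteq> {..Max (q ` {..n})}" by simp
  qed
  have meas: "range S \<subseteq> sets lborel" using A by (auto simp: S_def)
  have "A - (\<Union>n. S n) \<subseteq> {x\<in>A. \<forall>y\<in>A. y \<le> x}"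
  proof (safe, rule ccontr)
    fix x y assume x: "x \<in> A" "x \<notin> (\<Union>n. S n)" and y: "y \<in> A" "\<not> y \<le> x"
    obtain p where p: "p \<in> \<rat>" "x < p" "p < y" using Rats_dense_in_real[of x y] y by auto
    hence "p \<in> range q" using y(1) p unfolding q Q_def by (auto intro!: bexI[of _ y])
    then obtain n where "p = q n" by auto
    moreover have "q n \<le> Max (q ` {..n})" by (rule Max_ge) auto
    ultimately have "x \<le> Max (q ` {..n})" using p by linarith
    hence "x \<in> S n" using x by (auto simp: S_def)
    thus False using x by auto
  qed
  moreover have "finite {x\<in>A. \<forall>y\<in>A. y \<le> x}"
  proof (cases "\<exists>m. m \<in> {x\<in>A. \<forall>y\<in>A. y \<le> x}")
    case True
    then obtain m where "m \<in> {x\<in>A. \<forall>y\<in>A. y \<le> x}" ..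
    hence "{x\<in>A. \<forall>y\<in>A. y \<le> x} \<subseteq> {m}" by (auto intro: antisym)
    thus ?thesis by (rule finite_subset) simp
  next
    case False
    hence "{x\<in>A. \<forall>y\<in>A. y \<le> x} = {}" by blast
    thus ?thesis by (simp only: finite.emptyI)
  qed
  ultimately have fin: "finite (A - (\<Union>n. S n))" by (rule finite_subset)
  have sub: "(\<Union>n. S n) \<subseteq> A" by (auto simp: S_def)
  have "emeasure lborel A \<le> emeasure lborel (\<Union>n. S n) + emeasure lborel (A - (\<Union>n. S n))"
    using A meas by (subst plus_emeasure) (use sub in \<open>auto intro!: emeasure_mono\<close>)
  also have "emeasure lborel (A - (\<Union>n. S n)) = 0"
    by (rule emeasure_lborel_countable[OF countable_finite[OF fin]])
  also have "emeasure lborel (\<Union>n. S n) = (SUP n. emeasure lborel (S n))"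
    by (rule SUP_emeasure_incseq[symmetric, OF meas inc])
  also have "\<dots> \<le> (SUP a\<in>A. emeasure lborel (A \<inter> {..a}))"
  proof (rule SUP_least)
    fix n
    obtain a where a: "a \<in> A" "Max (q ` {..n}) \<le> a" using qmem[of n] by (auto simp: Q_def)
    have "emeasure lborel (S n) \<le> emeasure lborel (A \<inter> {..a})"
      using A by (intro emeasure_mono) (use a(2) in \<open>auto simp: S_def simp del: Max_le_iff\<close>)
    also have "\<dots> \<le> (SUP a\<in>A. emeasure lborel (A \<inter> {..a}))" using a by (intro SUP_upper) auto
    finally show "emeasure lborel (S n) \<le> (SUP a\<in>A. emeasure lborel (A \<inter> {..a}))" .
  qed
  finally show "emeasure lborel A \<le> (SUP a\<in>A. emeasure lborel (A \<inter> {..a}))" by simp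
qed

lemma emeasure_lborel_affine_image:
  fixes A :: "real set" assumes A: "A \<in> sets borel" and c: "c > 0"
  shows "emeasure lborel ((\<lambda>x. c * x + t) ` A) = ennreal c * emeasure lborel A"
    and "(\<lambda>x. c * x + t) ` A \<in> sets borel"
proof -
  have eq: "(\<lambda>x. c * x + t) ` A = (\<lambda>y. (y - t) / c) -` A"
  proof safe
    fix y assume "(y - t) / c \<in> A"
    thus "y \<in> (\<lambda>x. c * x + t) ` A" using c by (intro image_eqI[of _ _ "(y - t) / c"]) auto
  qed (use c in auto)
  show m: "(\<lambda>x. c * x + t) ` A \<in> sets borel"
    unfolding eq using A by (auto intro!: measurable_sets_borel[where A=A and f="\<lambda>y. (y-t)/c"])
  have "emeasure lborel ((\<lambda>x. c * x + t) ` A) = (\<integral>\<^sup>+ y. indicator ((\<lambda>x. c * x + t) ` A) y \<partial>lborel)"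
    using m by simp
  also have "\<dots> = ennreal \<bar>c\<bar> * (\<integral>\<^sup>+ x. indicator ((\<lambda>x. c * x + t) ` A) (t + c * x) \<partial>lborel)"
    using m c by (intro nn_integral_real_affine) auto
  also have "(\<lambda>x. indicator ((\<lambda>x. c * x + t) ` A) (t + c * x)) = (indicator A :: real \<Rightarrow> ennreal)"
    using c by (auto simp: indicator_def fun_eq_iff)
  finally show "emeasure lborel ((\<lambda>x. c * x + t) ` A) = ennreal c * emeasure lborel A"
    using A c by simp
qed

text \<open>Cut the first set above a point $a$ of it and the second below a point $b$ of it. The midpoints with $b$
fixed and those with $a$ fixed then lie on the two sides of $(a+b)/2$, so the halved translates
of the two parts overlap in at most one point, and both lie in the third set.\<close>

lemma brunn_minkowski_real:
  fixes A B C :: "real set"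
  assumes A: "A \<in> sets borel" "A \<noteq> {}" and B: "B \<in> sets borel" "B \<noteq> {}" and C: "C \<in> sets borel"
    and sub: "\<And>x y. x \<in> A \<Longrightarrow> y \<in> B \<Longrightarrow> (x + y) / 2 \<in> C"
  shows "emeasure lborel A + emeasure lborel B \<le> 2 * emeasure lborel C"
proof -
  have umB: "uminus ` B \<in> sets borel"
  proof -
    have "uminus ` B = uminus -` B" by (auto intro!: image_eqI[of _ _ "- _"])
    thus ?thesis using B by (auto intro!: measurable_sets_borel[where A=B and f=uminus])
  qed
  have B_eq: "emeasure lborel B = (SUP b\<in>B. emeasure lborel (B \<inter> {b..}))"
  proof -
    have um: "emeasure lborel (uminus ` S) = emeasure lborel S" if "S \<in> sets borel" for S :: "real set"
    proof -
      have "uminus ` S = uminus -` S" by (auto intro!: image_eqI[of _ _ "- _"])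
      hence "emeasure lborel (uminus ` S) = emeasure (distr lborel borel uminus) S"
        using that by (simp add: emeasure_distr)
      also have "distr lborel borel uminus = (lborel :: real measure)" by (rule lborel_distr_uminus)
      finally show ?thesis .
    qed
    have "emeasure lborel B = emeasure lborel (uminus ` B)" using um B by simp
    also have "\<dots> = (SUP a\<in>uminus ` B. emeasure lborel (uminus ` B \<inter> {..a}))"
      using B by (intro emeasure_lborel_eq_SUP_initial_segments umB) auto
    also have "\<dots> = (SUP b\<in>B. emeasure lborel (uminus ` B \<inter> {..-b}))" by (simp add: image_image)
    also have "\<dots> = (SUP b\<in>B. emeasure lborel (B \<inter> {b..}))"
    proof (intro SUP_cong refl)
      fix b assume "b \<in> B"
      have "uminus ` B \<inter> {..-b} = uminus ` (B \<inter> {b..})" by auto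
      thus "emeasure lborel (uminus ` B \<inter> {..-b}) = emeasure lborel (B \<inter> {b..})"
        using um[of "B \<inter> {b..}"] B by simp
    qed
    finally show ?thesis .
  qed
  have key: "emeasure lborel (A \<inter> {..a}) + emeasure lborel (B \<inter> {b..}) \<le> 2 * emeasure lborel C"
    if ab: "a \<in> A" "b \<in> B" for a b
  proof -
    let ?L = "(\<lambda>x. (1/2) * x + b/2) ` (A \<inter> {..a})" and ?R = "(\<lambda>x. (1/2) * x + a/2) ` (B \<inter> {b..})"
    have LR: "?L \<in> sets borel" "?R \<in> sets borel"
      using A B by (intro emeasure_lborel_affine_image(2); simp)+
    have "emeasure lborel ?L + emeasure lborel ?R = emeasure lborel (?L \<union> ?R) + emeasure lborel (?L \<inter> ?R)"
      using LR by (intro emeasure_Un_Int) auto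
    also have "emeasure lborel (?L \<inter> ?R) = 0"
    proof -
      have "?L \<inter> ?R \<subseteq> {(a + b) / 2}" by (auto simp: field_simps)
      thus ?thesis by (intro emeasure_lborel_countable) (rule countable_subset, auto)
    qed
    also have "emeasure lborel (?L \<union> ?R) \<le> emeasure lborel C"
    proof (intro emeasure_mono)
      show "?L \<union> ?R \<subseteq> C"
      proof -
        have "1/2 * x + b/2 \<in> C" if "x \<in> A" for x
          using sub[OF that ab(2)] by (simp add: add_divide_distrib)
        moreover have "1/2 * y + a/2 \<in> C" if "y \<in> B" for y
          using sub[OF ab(1) that] by (simp add: add_divide_distrib add.commute)
        ultimately show ?thesis by auto
      qed
    qed (use C in auto)
    finally have "emeasure lborel ?L + emeasure lborel ?R \<le> emeasure lborel C" by simp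
    hence *: "ennreal (1/2) * (emeasure lborel (A \<inter> {..a}) + emeasure lborel (B \<inter> {b..})) \<le> emeasure lborel C"
      using A B by (simp only: emeasure_lborel_affine_image(1)[of "A \<inter> {..a}" "1/2" "b/2"]
          emeasure_lborel_affine_image(1)[of "B \<inter> {b..}" "1/2" "a/2"] distrib_left sets.Int atMost_borel atLeast_borel)
    have "2 * (ennreal (1/2) * (emeasure lborel (A \<inter> {..a}) + emeasure lborel (B \<inter> {b..}))) \<le> 2 * emeasure lborel C"
      by (rule mult_left_mono[OF *]) simp
    moreover have "2 * ennreal (1/2) = 1"
    proof -
      have "2 * ennreal (1/2) = ennreal (2 * (1/2))" by (subst ennreal_mult) auto
      thus ?thesis by simp
    qed
    ultimately show ?thesis by (simp only: mult.assoc[symmetric] mult_1)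
  qed
  have "emeasure lborel A + emeasure lborel B
      = (SUP a\<in>A. emeasure lborel (A \<inter> {..a}) + (SUP b\<in>B. emeasure lborel (B \<inter> {b..})))"
    unfolding emeasure_lborel_eq_SUP_initial_segments[OF A] B_eq
    using A by (subst ennreal_SUP_add_left) auto
  also have "\<dots> \<le> 2 * emeasure lborel C"
  proof (rule SUP_least)
    fix a assume a: "a \<in> A"
    have "emeasure lborel (A \<inter> {..a}) + (SUP b\<in>B. emeasure lborel (B \<inter> {b..}))
       = (SUP b\<in>B. emeasure lborel (A \<inter> {..a}) + emeasure lborel (B \<inter> {b..}))"
      using B by (subst ennreal_SUP_add_right) auto
    also have "\<dots> \<le> 2 * emeasure lborel C" using key a by (intro SUP_least) auto
    finally show "emeasure lborel (A \<inter> {..a}) + (SUP b\<in>B. emeasure lborel (B \<inter> {b..})) \<le> 2 * emeasure lborel C" .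
  qed
  finally show ?thesis .
qed

text \<open>The subgraph of the function is measured along both axes.\<close>

lemma nn_integral_layer_cake:
  fixes f :: "real \<Rightarrow> ennreal"
  assumes [measurable]: "f \<in> borel_measurable borel"
  shows "(\<integral>\<^sup>+x. f x \<partial>lborel) = (\<integral>\<^sup>+u. indicator {0<..} u * emeasure lborel {x. ennreal u < f x} \<partial>lborel)"
proof -
  have fib: "f x = (\<integral>\<^sup>+u. indicator {u. 0 < u \<and> ennreal u < f x} u \<partial>lborel)" for x
  proof (cases "f x")
    case (real r)
    hence "{u. 0 < u \<and> ennreal u < f x} = {0<..<r}" by (auto simp: ennreal_less_iff)
    thus ?thesis using real by simp
  next
    case top
    hence *: "{u. 0 < u \<and> ennreal u < f x} = {0<..}" by auto
    have "of_nat n \<le> emeasure lborel {0::real<..}" for n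
    proof -
      have "of_nat n = emeasure lborel {0::real<..real n}" by (simp add: ennreal_of_nat_eq_real_of_nat)
      also have "\<dots> \<le> emeasure lborel {0::real<..}" by (intro emeasure_mono) auto
      finally show ?thesis .
    qed
    hence "emeasure lborel {0::real<..} = top_class.top"
      by (metis SUP_least ennreal_SUP_of_nat_eq_top top.extremum_uniqueI)
    thus ?thesis using top * by simp
  qed
  have "(\<integral>\<^sup>+x. f x \<partial>lborel) = (\<integral>\<^sup>+x. (\<integral>\<^sup>+u. indicator {u. 0 < u \<and> ennreal u < f x} u \<partial>lborel) \<partial>lborel)"
    by (subst fib) simp
  also have "\<dots> = (\<integral>\<^sup>+x. (\<integral>\<^sup>+u. indicator {p. 0 < snd p \<and> ennreal (snd p) < f (fst p)} (x, u) \<partial>lborel) \<partial>lborel)"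
    by (intro nn_integral_cong) (auto simp: indicator_def)
  also have "\<dots> = (\<integral>\<^sup>+u. (\<integral>\<^sup>+x. indicator {p. 0 < snd p \<and> ennreal (snd p) < f (fst p)} (x, u) \<partial>lborel) \<partial>lborel)"
    by (subst lborel_pair.Fubini') (auto simp: split_beta')
  also have "\<dots> = (\<integral>\<^sup>+u. (\<integral>\<^sup>+x. indicator {0<..} u * indicator {x. ennreal u < f x} x \<partial>lborel) \<partial>lborel)"
    by (intro nn_integral_cong) (auto simp: indicator_def)
  also have "\<dots> = (\<integral>\<^sup>+u. indicator {0<..} u * emeasure lborel {x. ennreal u < f x} \<partial>lborel)"
    by (intro nn_integral_cong) (simp add: nn_integral_cmult)
  finally show ?thesis .
qed

text \<open>The Prekopa--Leindler inequality with exponent 1/2. Squaring avoids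
square roots of extended nonnegative reals, and keeping the measure as a parameter lets the property pass
to products.\<close>

definition midpoint_prekopa_leindler :: "'a::real_vector measure \<Rightarrow> bool" where
  "midpoint_prekopa_leindler M \<longleftrightarrow>
     (\<forall>f g h. f \<in> borel_measurable M \<longrightarrow> g \<in> borel_measurable M \<longrightarrow> h \<in> borel_measurable M \<longrightarrow>
        (\<forall>x y. f x * g y \<le> (h ((1/2) *\<^sub>R (x + y)))\<^sup>2) \<longrightarrow>
        (\<integral>\<^sup>+x. f x \<partial>M) * (\<integral>\<^sup>+x. g x \<partial>M) \<le> (\<integral>\<^sup>+x. h x \<partial>M)\<^sup>2)"

text \<open>With both suprema equal to 1, the superlevel sets of $f$ and $g$ are both nonempty at every level
below 1 and both empty from 1 on, so that the one-dimensional Brunn--Minkowski inequality applies level by level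
and gives even the arithmetic mean of the integrals.\<close>

lemma prekopa_leindler_real_normalized:
  fixes f g h :: "real \<Rightarrow> ennreal"
  assumes [measurable]: "f \<in> borel_measurable borel" "g \<in> borel_measurable borel" "h \<in> borel_measurable borel"
    and sup: "(SUP x. f x) = 1" "(SUP x. g x) = 1"
    and le: "\<And>x y. f x * g y \<le> (h ((x + y) / 2))\<^sup>2"
  shows "(\<integral>\<^sup>+x. f x \<partial>lborel) + (\<integral>\<^sup>+x. g x \<partial>lborel) \<le> 2 * (\<integral>\<^sup>+x. h x \<partial>lborel)"
proof -
  have lev: "emeasure lborel {x. ennreal u < f x} + emeasure lborel {x. ennreal u < g x}
     \<le> 2 * emeasure lborel {x. ennreal u < h x}" if u: "0 < u" for u
  proof (cases "u < 1")
    case True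
    hence u1: "ennreal u < 1" using u by (simp add: ennreal_less_one_iff)
    show ?thesis
    proof (rule brunn_minkowski_real)
      show "{x. ennreal u < f x} \<noteq> {}" "{x. ennreal u < g x} \<noteq> {}"
        using u1 less_SUP_iff[of "ennreal u" f UNIV] less_SUP_iff[of "ennreal u" g UNIV] sup by auto
      fix x y assume xy: "x \<in> {x. ennreal u < f x}" "y \<in> {x. ennreal u < g x}"
      have "(ennreal u)\<^sup>2 < f x * g y"
      proof -
        have "(ennreal u)\<^sup>2 < ennreal u * g y"
          unfolding power2_eq_square using xy u by (intro ennreal_mult_strict_left_mono) auto
        also have "\<dots> \<le> f x * g y" using xy by (intro mult_right_mono) auto
        finally show ?thesis .
      qed
      also have "\<dots> \<le> (h ((x + y) / 2))\<^sup>2" by (rule le)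
      finally have "ennreal u < h ((x + y) / 2)"
        by (meson linorder_not_less power_mono zero_le)
      thus "(x + y) / 2 \<in> {x. ennreal u < h x}" by simp
    qed (auto simp flip: vimage_def simp: pred_def[symmetric])
  next
    case False
    have "f x \<le> 1" "g x \<le> 1" for x using sup by (metis SUP_upper UNIV_I)+
    moreover have "1 \<le> ennreal u" using False by (simp add: ennreal_ge_1)
    ultimately have "{x. ennreal u < f x} = {}" "{x. ennreal u < g x} = {}"
      by (auto simp del: ennreal_ge_1 simp: not_less intro: order_trans[where y = 1])
    thus ?thesis by (simp only: emeasure_empty) simp
  qed
  have "(\<integral>\<^sup>+x. f x \<partial>lborel) + (\<integral>\<^sup>+x. g x \<partial>lborel)
    = (\<integral>\<^sup>+u. indicator {0<..} u * emeasure lborel {x. ennreal u < f x} + indicator {0<..} u * emeasure lborel {x. ennreal u < g x} \<partial>lborel)"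
    unfolding nn_integral_layer_cake[OF assms(1)] nn_integral_layer_cake[OF assms(2)]
    by (rule nn_integral_add[symmetric]) measurable
  also have "\<dots> \<le> (\<integral>\<^sup>+u. 2 * (indicator {0<..} u * emeasure lborel {x. ennreal u < h x}) \<partial>lborel)"
    using lev by (intro nn_integral_mono) (auto simp: indicator_def)
  also have "\<dots> = 2 * (\<integral>\<^sup>+x. h x \<partial>lborel)"
    unfolding nn_integral_layer_cake[OF assms(3)] by (rule nn_integral_cmult) measurable
  finally show ?thesis .
qed

lemma ennreal_mult_le_square_of_add_le:
  fixes X Y Z :: ennreal
  assumes "X + Y \<le> 2 * Z"
  shows "X * Y \<le> Z\<^sup>2"
proof (cases Z)
  case (real z)
  hence "2 * Z < top_class.top" by (simp add: ennreal_mult_less_top)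
  hence "X + Y < top_class.top" using assms by (rule le_less_trans[rotated])
  then obtain x y where xy: "X = ennreal x" "0 \<le> x" "Y = ennreal y" "0 \<le> y"
    by (cases X; cases Y) auto
  have "ennreal (x + y) \<le> ennreal (2 * z)"
    using assms xy real by (simp add: ennreal_mult)
  hence "x + y \<le> 2 * z" using real by (subst (asm) ennreal_le_iff) auto
  hence "(x + y)\<^sup>2 \<le> (2 * z)\<^sup>2" using xy by (intro power_mono) auto
  moreover have "4 * (x * y) \<le> (x + y)\<^sup>2"
    using zero_le_power2[of "x - y"] by (simp add: power2_eq_square algebra_simps)
  ultimately have "x * y \<le> z\<^sup>2" by simp
  thus ?thesis using xy real by (simp add: ennreal_power ennreal_mult[symmetric])
next
  case top
  thus ?thesis by (simp add: power2_eq_square)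
qed

text \<open>Rescaling the functions by their suprema reduces to the normalized case; the arithmetic--geometric mean
inequality turns the sum back into the product.\<close>

lemma prekopa_leindler_real_bounded:
  fixes f g h :: "real \<Rightarrow> ennreal"
  assumes [measurable]: "f \<in> borel_measurable borel" "g \<in> borel_measurable borel" "h \<in> borel_measurable borel"
    and bd: "\<And>x. f x \<le> ennreal m" "\<And>x. g x \<le> ennreal m"
    and le: "\<And>x y. f x * g y \<le> (h ((x + y) / 2))\<^sup>2"
  shows "(\<integral>\<^sup>+x. f x \<partial>lborel) * (\<integral>\<^sup>+x. g x \<partial>lborel) \<le> (\<integral>\<^sup>+x. h x \<partial>lborel)\<^sup>2"
proof (cases "(SUP x. f x) = 0 \<or> (SUP x. g x) = 0")
  case True
  hence "(\<forall>x. f x = 0) \<or> (\<forall>x. g x = 0)" by (metis SUP_upper UNIV_I le_zero_eq)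
  thus ?thesis by auto
next
  case False
  have fin: "(SUP x. f x) < top_class.top" "(SUP x. g x) < top_class.top"
    using bd by (auto intro!: le_less_trans[OF SUP_least ennreal_less_top])
  obtain s where s: "(SUP x. f x) = ennreal s" "s > 0"
    using fin False by (cases "SUP x. f x") (auto simp: less_le)
  obtain t where t: "(SUP x. g x) = ennreal t" "t > 0"
    using fin False by (cases "SUP x. g x") (auto simp: less_le)
  let ?s = "ennreal (1 / s)" and ?t = "ennreal (1 / t)" and ?r = "ennreal (1 / sqrt (s * t))"
  have r2: "?r\<^sup>2 = ?s * ?t"
    using s t by (simp add: ennreal_power power_divide flip: ennreal_mult)
  have "(\<integral>\<^sup>+x. ?s * f x \<partial>lborel) + (\<integral>\<^sup>+x. ?t * g x \<partial>lborel) \<le> 2 * (\<integral>\<^sup>+x. ?r * h x \<partial>lborel)"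
  proof (rule prekopa_leindler_real_normalized)
    show "(SUP x. ?s * f x) = 1" "(SUP x. ?t * g x) = 1"
      using s t by (simp_all add: s(1) t(1) flip: SUP_mult_left_ennreal ennreal_mult'')
    fix x y
    have "?s * f x * (?t * g y) = ?r\<^sup>2 * (f x * g y)" unfolding r2 by (simp add: mult_ac)
    also have "\<dots> \<le> ?r\<^sup>2 * (h ((x + y) / 2))\<^sup>2" by (intro mult_left_mono le) simp
    finally show "?s * f x * (?t * g y) \<le> (?r * h ((x + y) / 2))\<^sup>2" by (simp add: power_mult_distrib)
  qed measurable
  from ennreal_mult_le_square_of_add_le[OF this]
  have *: "?r\<^sup>2 * ((\<integral>\<^sup>+x. f x \<partial>lborel) * (\<integral>\<^sup>+x. g x \<partial>lborel)) \<le> ?r\<^sup>2 * (\<integral>\<^sup>+x. h x \<partial>lborel)\<^sup>2"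
    by (subst (asm) (1 2 3) nn_integral_cmult) (measurable, simp add: power_mult_distrib mult_ac r2)
  have "ennreal (s * t) * (?r\<^sup>2 * ((\<integral>\<^sup>+x. f x \<partial>lborel) * (\<integral>\<^sup>+x. g x \<partial>lborel)))
      \<le> ennreal (s * t) * (?r\<^sup>2 * (\<integral>\<^sup>+x. h x \<partial>lborel)\<^sup>2)"
    by (rule mult_left_mono[OF *]) simp
  moreover have "ennreal (s * t) * ?r\<^sup>2 = 1"
    using s t by (simp add: r2 flip: ennreal_mult)
  ultimately show ?thesis by (simp only: mult.assoc[symmetric] mult_1)
qed

text \<open>Truncation at two independent integer heights removes the boundedness assumption, because the
integral of $h$ does not depend on the heights.\<close>

lemma midpoint_prekopa_leindler_real: "midpoint_prekopa_leindler (lborel :: real measure)"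
  unfolding midpoint_prekopa_leindler_def
proof (intro allI impI)
  fix f g h :: "real \<Rightarrow> ennreal"
  assume m[measurable]: "f \<in> borel_measurable lborel" "g \<in> borel_measurable lborel" "h \<in> borel_measurable lborel"
    and le: "\<forall>x y. f x * g y \<le> (h ((1/2) *\<^sub>R (x + y)))\<^sup>2"
  have trunc: "(SUP n. \<integral>\<^sup>+x. min (f x) (ennreal (real n)) \<partial>lborel) = (\<integral>\<^sup>+x. f x \<partial>lborel)"
    if [measurable]: "f \<in> borel_measurable lborel" for f :: "real \<Rightarrow> ennreal"
  proof -
    have "(\<integral>\<^sup>+x. f x \<partial>lborel) = (\<integral>\<^sup>+x. (SUP n. min (f x) (ennreal (real n))) \<partial>lborel)"
    proof (intro nn_integral_cong)
      fix x
      show "f x = (SUP n. min (f x) (ennreal (real n)))"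
      proof (cases "f x")
        case (real r)
        obtain n :: nat where "r \<le> real n" using real_arch_simple by blast
        hence "f x \<le> min (f x) (ennreal (real n))" using real by (auto intro: ennreal_leI)
        also have "\<dots> \<le> (SUP n. min (f x) (ennreal (real n)))" by (rule SUP_upper) simp
        finally show ?thesis by (auto intro!: antisym SUP_least)
      next
        case top
        have "(SUP n. ennreal (real n)) = top_class.top"
          unfolding ennreal_of_nat_eq_real_of_nat[symmetric] by (rule ennreal_SUP_of_nat_eq_top)
        moreover have "(SUP n. min (f x) (ennreal (real n))) = (SUP n. ennreal (real n))"
          using top by simp
        ultimately show ?thesis using top by (simp only:)
      qed
    qed
    also have "\<dots> = (SUP n. \<integral>\<^sup>+x. min (f x) (ennreal (real n)) \<partial>lborel)"
    proof (intro nn_integral_monotone_convergence_SUP)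
      show "incseq (\<lambda>n x. min (f x) (ennreal (real n)))"
        unfolding incseq_def le_fun_def by (intro allI impI min.mono order_refl ennreal_leI) simp
    qed measurable
    finally show ?thesis ..
  qed
  have fin: "(\<integral>\<^sup>+x. min (f x) (ennreal (real n)) \<partial>lborel) * (\<integral>\<^sup>+x. min (g x) (ennreal (real k)) \<partial>lborel)
      \<le> (\<integral>\<^sup>+x. h x \<partial>lborel)\<^sup>2" for n k
  proof (rule prekopa_leindler_real_bounded[where m = "real (max n k)"])
    fix x y :: real
    show "min (f x) (ennreal (real n)) \<le> ennreal (real (max n k))"
      "min (g x) (ennreal (real k)) \<le> ennreal (real (max n k))"
      by (auto intro!: min.coboundedI2 ennreal_leI)
    have "min (f x) (ennreal (real n)) * min (g y) (ennreal (real k)) \<le> f x * g y"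
      by (intro mult_mono) auto
    also have "\<dots> \<le> (h ((x + y) / 2))\<^sup>2" using le[rule_format, of x y] by simp
    finally show "min (f x) (ennreal (real n)) * min (g y) (ennreal (real k)) \<le> (h ((x + y) / 2))\<^sup>2" .
  qed (use m in auto)
  show "(\<integral>\<^sup>+x. f x \<partial>lborel) * (\<integral>\<^sup>+x. g x \<partial>lborel) \<le> (\<integral>\<^sup>+x. h x \<partial>lborel)\<^sup>2"
    unfolding trunc[OF m(1), symmetric] trunc[OF m(2), symmetric]
    unfolding SUP_mult_left_ennreal SUP_mult_right_ennreal
    by (intro SUP_least fin)
qed

text \<open>The integrals over the fibres satisfy the same hypothesis, now on the first factor.\<close>

lemma midpoint_prekopa_leindler_pair:
  assumes A: "midpoint_prekopa_leindler (lborel :: 'a::euclidean_space measure)"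
    and B: "midpoint_prekopa_leindler (lborel :: 'b::euclidean_space measure)"
  shows "midpoint_prekopa_leindler (lborel :: ('a \<times> 'b) measure)"
  unfolding midpoint_prekopa_leindler_def lborel_prod[symmetric]
proof (intro allI impI)
  fix f g h :: "'a \<times> 'b \<Rightarrow> ennreal"
  assume m[measurable]: "f \<in> borel_measurable (lborel \<Otimes>\<^sub>M lborel)" "g \<in> borel_measurable (lborel \<Otimes>\<^sub>M lborel)"
      "h \<in> borel_measurable (lborel \<Otimes>\<^sub>M lborel)"
    and le: "\<forall>x y. f x * g y \<le> (h ((1/2) *\<^sub>R (x + y)))\<^sup>2"
  have sec: "(\<integral>\<^sup>+y. f (x, y) \<partial>lborel) * (\<integral>\<^sup>+y. g (x', y) \<partial>lborel)
      \<le> (\<integral>\<^sup>+y. h ((1/2) *\<^sub>R (x + x'), y) \<partial>lborel)\<^sup>2" for x x'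
  proof (rule B[unfolded midpoint_prekopa_leindler_def, rule_format])
    fix y y'
    show "f (x, y) * g (x', y') \<le> (h ((1/2) *\<^sub>R (x + x'), (1/2) *\<^sub>R (y + y')))\<^sup>2"
      using le[rule_format, of "(x, y)" "(x', y')"] by simp
  qed measurable
  show "(\<integral>\<^sup>+z. f z \<partial>(lborel \<Otimes>\<^sub>M lborel)) * (\<integral>\<^sup>+z. g z \<partial>(lborel \<Otimes>\<^sub>M lborel))
      \<le> (\<integral>\<^sup>+z. h z \<partial>(lborel \<Otimes>\<^sub>M lborel))\<^sup>2"
    unfolding lborel.nn_integral_fst[OF m(1), symmetric] lborel.nn_integral_fst[OF m(2), symmetric]
      lborel.nn_integral_fst[OF m(3), symmetric]
    by (rule A[unfolded midpoint_prekopa_leindler_def, rule_format]) (auto intro: sec)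
qed

section \<open>Volumes in three-dimensional space and Brunn--Minkowski\<close>

text \<open>Volumes are computed by iterated integration over nested pairs; this isometry carries
them to the Euclidean space of the statement.\<close>

definition vec3 :: "real \<times> real \<times> real \<Rightarrow> real ^ 3" where
  "vec3 p = vector [fst p, fst (snd p), snd (snd p)]"

lemma vec3_nth [simp]: "vec_nth (vec3 p) 1 = fst p" "vec_nth (vec3 p) 2 = fst (snd p)" "vec_nth (vec3 p) 3 = snd (snd p)"
  by (simp_all add: vec3_def vector_3)

lemma vec3_add: "vec3 (p + q) = vec3 p + vec3 q"
  by (simp add: Finite_Cartesian_Product.vec_eq_iff forall_3)

lemma vec3_scaleR: "vec3 (c *\<^sub>R p) = c *\<^sub>R vec3 p"
  by (simp add: Finite_Cartesian_Product.vec_eq_iff forall_3)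

lemma linear_vec3: "linear vec3"
  by (rule linearI) (simp_all add: vec3_add vec3_scaleR)

lemma inj_vec3: "inj vec3"
  by (rule injI) (auto simp: Finite_Cartesian_Product.vec_eq_iff forall_3 prod_eq_iff)

lemma continuous_on_vec3 [continuous_intros]: "continuous_on S vec3"
  by (intro linear_continuous_on) (simp add: linear_vec3 linear_linear)

lemma vec3_measurable [measurable]: "vec3 \<in> borel_measurable borel"
  by (rule borel_measurable_continuous_onI) (rule continuous_on_vec3)

lemma Basis_vec3: "(Basis :: (real^3) set) = {axis 1 1, axis 2 1, axis 3 1}"
  by (auto simp: Basis_vec_def UNIV_3)

lemma emeasure_lborel_Times:
  fixes A :: "'a::euclidean_space set" and B :: "'b::euclidean_space set"
  assumes "A \<in> sets borel" "B \<in> sets borel"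
  shows "emeasure lborel (A \<times> B) = emeasure lborel A * emeasure lborel B"
proof -
  have "emeasure (lborel \<Otimes>\<^sub>M lborel) (A \<times> B) = emeasure lborel A * emeasure lborel B"
    by (rule lborel.emeasure_pair_measure_Times) (use assms in auto)
  thus ?thesis by (simp only: lborel_prod)
qed

lemma lborel_vec3: "distr lborel borel vec3 = (lborel :: (real^3) measure)"
proof (rule lborel_eqI[symmetric])
  fix l u :: "real^3"
  assume lu: "\<And>b. b \<in> Basis \<Longrightarrow> inner l b \<le> inner u b"
  have le: "vec_nth l i \<le> vec_nth u i" for i
    using lu[of "axis i 1"] by (simp add: inner_axis axis_in_Basis_iff)
  have "vec3 -` box l u = box (vec_nth l 1) (vec_nth u 1) \<times> box (vec_nth l 2) (vec_nth u 2) \<times> box (vec_nth l 3) (vec_nth u 3)"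
    by (auto simp: mem_box_cart forall_3 box_real)
  hence "emeasure (distr lborel borel vec3) (box l u)
    = emeasure lborel (box (vec_nth l 1) (vec_nth u 1) \<times> box (vec_nth l 2) (vec_nth u 2) \<times> box (vec_nth l 3) (vec_nth u 3))"
    by (simp add: emeasure_distr)
  also have "\<dots> = ennreal (vec_nth u 1 - vec_nth l 1) * (ennreal (vec_nth u 2 - vec_nth l 2) * ennreal (vec_nth u 3 - vec_nth l 3))"
    using le by (simp add: emeasure_lborel_Times borel_Times)
  also have "\<dots> = ennreal (\<Prod>b\<in>Basis. inner (u - l) b)"
  proof -
    have "axis 1 1 \<noteq> (axis 2 1 :: real^3)" "axis 1 1 \<noteq> (axis 3 1 :: real^3)" "axis 2 1 \<noteq> (axis 3 1 :: real^3)"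
      by (auto simp: axis_eq_axis)
    thus ?thesis using le unfolding Basis_vec3
      by (simp add: inner_axis flip: ennreal_mult)
  qed
  finally show "emeasure (distr lborel borel vec3) (box l u) = ennreal (\<Prod>b\<in>Basis. inner (u - l) b)" .
qed simp

lemma emeasure_lborel_vec3:
  assumes "S \<in> sets borel"
  shows "emeasure lborel S = emeasure lborel (vec3 -` S)"
  using assms by (subst lborel_vec3[symmetric]) (simp add: emeasure_distr)

lemma measure_lebesgue_vec3_image:
  assumes "compact S"
  shows "measure lebesgue (vec3 ` S) = measure lborel S"
proof -
  have "compact (vec3 ` S)" using assms by (intro compact_continuous_image continuous_on_vec3)
  hence m: "vec3 ` S \<in> sets borel" by (simp add: borel_compact)
  have "emeasure lborel (vec3 ` S) = emeasure lborel S"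
    by (subst emeasure_lborel_vec3[OF m]) (simp add: inj_vimage_image_eq[OF inj_vec3])
  thus ?thesis using m by (simp add: measure_def)
qed

lemma midpoint_prekopa_leindler_vec3: "midpoint_prekopa_leindler (lborel :: (real ^ 3) measure)"
  unfolding midpoint_prekopa_leindler_def
proof (intro allI impI)
  fix f g h :: "real^3 \<Rightarrow> ennreal"
  assume [measurable]: "f \<in> borel_measurable lborel" "g \<in> borel_measurable lborel" "h \<in> borel_measurable lborel"
    and le: "\<forall>x y. f x * g y \<le> (h ((1/2) *\<^sub>R (x + y)))\<^sup>2"
  have eq: "(\<integral>\<^sup>+x. k x \<partial>lborel) = (\<integral>\<^sup>+p. k (vec3 p) \<partial>lborel)" if [measurable]: "k \<in> borel_measurable borel" for k
    by (subst lborel_vec3[symmetric]) (simp add: nn_integral_distr)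
  have PL: "midpoint_prekopa_leindler (lborel :: (real \<times> real \<times> real) measure)"
    by (intro midpoint_prekopa_leindler_pair midpoint_prekopa_leindler_real)
  have "(\<integral>\<^sup>+p. f (vec3 p) \<partial>lborel) * (\<integral>\<^sup>+p. g (vec3 p) \<partial>lborel) \<le> (\<integral>\<^sup>+p. h (vec3 p) \<partial>lborel)\<^sup>2"
  proof (rule PL[unfolded midpoint_prekopa_leindler_def, rule_format])
    fix p q
    show "f (vec3 p) * g (vec3 q) \<le> (h (vec3 ((1/2) *\<^sub>R (p + q))))\<^sup>2"
      unfolding vec3_add vec3_scaleR using le by blast
  qed measurable
  thus "(\<integral>\<^sup>+x. f x \<partial>lborel) * (\<integral>\<^sup>+x. g x \<partial>lborel) \<le> (\<integral>\<^sup>+x. h x \<partial>lborel)\<^sup>2"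
    by (simp add: eq)
qed

text \<open>The dimension-free form of the Brunn--Minkowski inequality: Prekopa--Leindler for the three
indicator functions.\<close>

lemma multiplicative_brunn_minkowski:
  fixes A B C :: "(real^3) set"
  assumes cpt: "compact A" "compact B" "compact C"
    and sub: "\<And>x y. x \<in> A \<Longrightarrow> y \<in> B \<Longrightarrow> (1/2) *\<^sub>R (x + y) \<in> C"
  shows "measure lebesgue A * measure lebesgue B \<le> (measure lebesgue C)\<^sup>2"
proof -
  have b: "A \<in> sets borel" "B \<in> sets borel" "C \<in> sets borel"
    by (rule borel_compact, rule cpt)+
  note b[measurable]
  have *: "(\<integral>\<^sup>+x. indicator A x \<partial>lborel) * (\<integral>\<^sup>+x. indicator B x \<partial>lborel) \<le> ((\<integral>\<^sup>+x. indicator C x \<partial>lborel)\<^sup>2 :: ennreal)"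
  proof (rule midpoint_prekopa_leindler_vec3[unfolded midpoint_prekopa_leindler_def, rule_format])
    fix x y
    show "indicator A x * indicator B y \<le> (indicator C ((1/2) *\<^sub>R (x + y)) :: ennreal)\<^sup>2"
    proof (cases "x \<in> A \<and> y \<in> B")
      case True
      hence "(1/2) *\<^sub>R (x + y) \<in> C" using sub by blast
      thus ?thesis using True by (simp only: indicator_simps) simp
    qed (auto simp: indicator_def)
  qed measurable
  have fin: "emeasure lborel S = ennreal (measure lebesgue S)" if "compact S" for S :: "(real^3) set"
  proof -
    have "emeasure lborel S < top_class.top"
      using emeasure_bounded_finite[OF compact_imp_bounded[OF that]] by simp
    hence "emeasure lborel S = ennreal (enn2real (emeasure lborel S))"
      by (rule ennreal_enn2real[symmetric])
    also have "enn2real (emeasure lborel S) = measure lebesgue S"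
      using borel_compact[OF that] by (simp add: measure_def)
    finally show ?thesis .
  qed
  have "ennreal (measure lebesgue A * measure lebesgue B) \<le> ennreal ((measure lebesgue C)\<^sup>2)"
    using * cpt by (simp add: fin ennreal_power ennreal_mult)
  thus ?thesis by (subst (asm) ennreal_le_iff) auto
qed

section \<open>Symmetric matrices of order three with one positive eigenvalue\<close>

abbreviation sym3 :: "real \<Rightarrow> real \<Rightarrow> real \<Rightarrow> real \<Rightarrow> real \<Rightarrow> real \<Rightarrow> real mat" where
  "sym3 a b c d e f \<equiv> mat_of_rows_list 3 [[a, b, c], [b, d, e], [c, e, f]]"

lemma cubic_slice_eq:
  "cubic_slice c 0 = sym3 (c (3,0,0)) (c (2,1,0)) (c (2,0,1)) (c (1,2,0)) (c (1,1,1)) (c (1,0,2))"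
  "cubic_slice c 1 = sym3 (c (2,1,0)) (c (1,2,0)) (c (1,1,1)) (c (0,3,0)) (c (0,2,1)) (c (0,1,2))"
  "cubic_slice c 2 = sym3 (c (2,0,1)) (c (1,1,1)) (c (1,0,2)) (c (0,2,1)) (c (0,1,2)) (c (0,0,3))"
  unfolding cubic_slice_def mat_of_rows_list_def
  by (auto intro!: eq_matI simp: unit_expo_def less_Suc_eq numeral_3_eq_3 numeral_2_eq_2)

lemma det_2x2:
  fixes A :: "'a :: comm_ring_1 mat"
  assumes "A \<in> carrier_mat 2 2"
  shows "det A = A$$(0,0) * A$$(1,1) - A$$(0,1) * A$$(1,0)"
proof -
  have "det A = (\<Sum>j<2. A $$ (0,j) * cofactor A 0 j)"
    by (rule laplace_expansion_row[OF assms]) simp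
  also have "\<dots> = A$$(0,0) * A$$(1,1) - A$$(0,1) * A$$(1,0)"
    using assms
    by (simp add: numeral_2_eq_2 lessThan_Suc cofactor_def det_single mat_delete_def)
  finally show ?thesis .
qed

lemma det_3x3:
  fixes A :: "'a :: comm_ring_1 mat"
  assumes "A \<in> carrier_mat 3 3"
  shows "det A = A$$(0,0) * (A$$(1,1) * A$$(2,2) - A$$(1,2) * A$$(2,1))
     - A$$(0,1) * (A$$(1,0) * A$$(2,2) - A$$(1,2) * A$$(2,0))
     + A$$(0,2) * (A$$(1,0) * A$$(2,1) - A$$(1,1) * A$$(2,0))"
proof -
  have "det A = (\<Sum>j<3. A $$ (0,j) * cofactor A 0 j)"
    by (rule laplace_expansion_row[OF assms]) simp
  also have "\<dots> = A$$(0,0) * det (mat_delete A 0 0) - A$$(0,1) * det (mat_delete A 0 1)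
      + A$$(0,2) * det (mat_delete A 0 2)"
    by (simp add: numeral_3_eq_3 lessThan_Suc cofactor_def numeral_2_eq_2)
  also have "\<dots> = A$$(0,0) * (A$$(1,1) * A$$(2,2) - A$$(1,2) * A$$(2,1))
     - A$$(0,1) * (A$$(1,0) * A$$(2,2) - A$$(1,2) * A$$(2,0))
     + A$$(0,2) * (A$$(1,0) * A$$(2,1) - A$$(1,1) * A$$(2,0))"
  proof -
    have c: "mat_delete A 0 j \<in> carrier_mat 2 2" for j
      using mat_delete_carrier[OF assms, of 0 j] by (simp add: numeral_2_eq_2)
    show ?thesis
      using assms unfolding det_2x2[OF c]
      by (simp add: mat_delete_def numeral_2_eq_2)
  qed
  finally show ?thesis .
qed

lemma char_poly_sym3:
  "char_poly (sym3 a b c d e f) =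
     [: - (a * (d * f - e\<^sup>2) - b * (b * f - c * e) + c * (b * e - c * d)),
        (a * d - b\<^sup>2) + (a * f - c\<^sup>2) + (d * f - e\<^sup>2), - (a + d + f), 1 :]"
proof -
  let ?M = "char_poly_matrix (sym3 a b c d e f)"
  have M: "?M \<in> carrier_mat 3 3"
    by (intro char_poly_matrix_closed) (auto simp: mat_of_rows_list_def)
  have entries: "?M $$ (0,0) = [:-a, 1:]" "?M $$ (0,1) = [:-b:]" "?M $$ (0,2) = [:-c:]"
    "?M $$ (1,0) = [:-b:]" "?M $$ (1,1) = [:-d, 1:]" "?M $$ (1,2) = [:-e:]"
    "?M $$ (2,0) = [:-c:]" "?M $$ (2,1) = [:-e:]" "?M $$ (2,2) = [:-f, 1:]"
    by (auto simp: char_poly_matrix_def mat_of_rows_list_def)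
  show ?thesis
    unfolding char_poly_def det_3x3[OF M] entries by (simp add: algebra_simps power2_eq_square)
qed

lemma monic_real_root_above:
  fixes g :: "real poly"
  assumes "lead_coeff g > 0" "poly g s \<le> 0"
  obtains m where "m \<ge> s" "poly g m = 0"
proof -
  obtain n where n: "\<And>x. x \<ge> n \<Longrightarrow> poly g x \<ge> lead_coeff g"
    using poly_pinfty_gt_lc[OF assms(1)] by blast
  have "poly g (max n s) \<ge> 0" using n[of "max n s"] assms by simp
  hence "\<exists>x\<ge>s. x \<le> max n s \<and> poly g x = 0"
    using assms by (intro IVT') (auto intro!: continuous_intros)
  thus ?thesis using that by blast
qed

text \<open>After splitting off the root above $k$, the cofactor is nonpositive at $s$ and therefore
has a root from $s$ on. Splitting off the first root is what counts multiplicities correctly when the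
two roots coincide.\<close>

lemma two_positive_roots:
  fixes p :: "real poly"
  assumes lc: "lead_coeff p > 0" and k: "poly p k \<le> 0" and s: "0 \<le> s" "s < k" "0 \<le> poly p s"
    and pos: "0 < s \<or> 0 < poly p s"
  shows "2 \<le> size {#t \<in># proots p. 0 < t#}"
proof -
  obtain l where l: "l \<ge> k" "poly p l = 0" using monic_real_root_above[OF lc k] .
  then obtain g where g: "p = [:-l, 1:] * g" using poly_eq_0_iff_dvd by blast
  have lcg: "lead_coeff g > 0" using lc unfolding g lead_coeff_mult by simp
  have ps: "poly p s = (s - l) * poly g s" by (simp add: g algebra_simps)
  have gs: "poly g s \<le> 0"
    using s l by (simp add: ps zero_le_mult_iff)
  obtain m where m: "m \<ge> s" "poly g m = 0" using monic_real_root_above[OF lcg gs] .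
  have "m > 0"
  proof (cases "s = 0")
    case True
    hence "poly g 0 \<noteq> 0" using pos ps by auto
    thus ?thesis using True m by (cases "m = 0") auto
  qed (use m s in simp)
  obtain h where h: "g = [:-m, 1:] * h" using m poly_eq_0_iff_dvd by blast
  have "h \<noteq> 0" using lcg h by auto
  hence "proots g = {#m#} + proots h" unfolding h by (subst proots_mult) auto
  moreover have "proots p = {#l#} + proots g" using lcg unfolding g by (subst proots_mult) auto
  ultimately show ?thesis using \<open>m > 0\<close> s l by simp
qed

lemma positive_roots_factor:
  fixes p :: "real poly"
  assumes "2 \<le> size {#t \<in># proots p. 0 < t#}"
  obtains l m h where "l > 0" "m > 0" "p = [:-l, 1:] * ([:-m, 1:] * h)"
proof -
  have p0: "p \<noteq> 0" using assms by auto
  have "{#t \<in># proots p. 0 < t#} \<noteq> {#}" using assms by (metis size_empty not_numeral_le_zero)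
  then obtain l where l: "l \<in># {#t \<in># proots p. 0 < t#}" by blast
  hence l0: "l > 0" "poly p l = 0" using p0 by auto
  then obtain g where g: "p = [:-l, 1:] * g" using poly_eq_0_iff_dvd by blast
  have g0: "g \<noteq> 0" using g p0 by auto
  have "proots p = {#l#} + proots g" using g0 unfolding g by (subst proots_mult) auto
  hence "1 \<le> size {#t \<in># proots g. 0 < t#}" using assms l0 by simp
  hence "{#t \<in># proots g. 0 < t#} \<noteq> {#}" by (metis size_empty not_one_le_zero)
  then obtain m where "m \<in># {#t \<in># proots g. 0 < t#}" by blast
  hence m0: "m > 0" "poly g m = 0" using g0 by auto
  then obtain h where "g = [:-m, 1:] * h" using poly_eq_0_iff_dvd by blast
  thus ?thesis using that g l0 m0 by blast
qed

text \<open>Two positive eigenvalues and a nonnegative determinant would make the third eigenvalue nonnegative, and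
then the second elementary symmetric function of the eigenvalues, which is the sum of the principal
minors, would be positive.\<close>

lemma num_pos_eigenvalues_sym3_le_1:
  assumes det: "a * (d * f - e\<^sup>2) - b * (b * f - c * e) + c * (b * e - c * d) \<ge> 0"
    and minors: "(a * d - b\<^sup>2) + (a * f - c\<^sup>2) + (d * f - e\<^sup>2) \<le> 0"
  shows "num_pos_eigenvalues (sym3 a b c d e f) \<le> 1"
proof (rule ccontr)
  let ?p = "char_poly (sym3 a b c d e f)"
  assume "\<not> ?thesis"
  hence "2 \<le> size {#t \<in># proots ?p. 0 < t#}" by (simp add: num_pos_eigenvalues_def)
  then obtain l m h where lm: "l > 0" "m > 0" and p: "?p = [:-l, 1:] * ([:-m, 1:] * h)"
    by (rule positive_roots_factor)
  have deg2: "degree ([:-l, 1:] * ([:-m, 1:] * h)) = 2 + degree h" if "h \<noteq> 0"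
  proof -
    have nz: "[:-m, 1:] * h \<noteq> 0" using that by (simp only: mult_eq_0_iff) simp
    have "degree ([:-l, 1:] * ([:-m, 1:] * h)) = degree [:-l, 1:] + degree ([:-m, 1:] * h)"
      by (rule degree_mult_eq) (use nz in auto)
    also have "degree ([:-m, 1:] * h) = degree [:-m, 1:] + degree h"
      by (rule degree_mult_eq) (use that in auto)
    finally show ?thesis by simp
  qed
  have "degree ?p = 3" by (simp add: char_poly_sym3)
  moreover have "h \<noteq> 0" using p by (auto simp: char_poly_sym3)
  ultimately have "2 + degree h = 3"
    by (metis p deg2)
  hence "degree h = 1" by simp
  obtain u g where ug: "h = pCons u g" by (cases h)
  hence "degree g = 0" using \<open>degree h = 1\<close> by (simp split: if_splits)
  then obtain v where h: "h = [:u, v:]" using ug degree_eq_zeroE by metis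
  have "coeff ?p 3 = v" "coeff ?p 1 = l * m * v - (l + m) * u" "coeff ?p 0 = l * m * u"
    unfolding p h by (simp_all add: numeral_3_eq_3 algebra_simps)
  moreover have "coeff ?p 3 = 1" "coeff ?p 1 \<le> 0" "coeff ?p 0 \<le> 0"
    using det minors unfolding char_poly_sym3 by (simp_all add: numeral_3_eq_3)
  ultimately have *: "l * m - (l + m) * u \<le> 0" "l * m * u \<le> 0" by simp_all
  have "l * m > 0" using lm by simp
  hence "u \<le> 0" using *(2) lm by (auto simp: mult_le_0_iff)
  hence "(l + m) * u \<le> 0" using lm by (simp add: mult_nonneg_nonpos)
  thus False using * \<open>l * m > 0\<close> by linarith
qed

text \<open>Cauchy interlacing by hand: the characteristic polynomial is nonpositive at the larger eigenvalue of
the leading block of order two and nonnegative at the smaller one, so it has a root above the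
larger one. A positive smaller eigenvalue of the block, or a negative determinant, would force a
second positive root.\<close>

lemma sym3_one_pos_eigenvalue:
  assumes pos: "a > 0" "b > 0" "d > 0"
    and one: "num_pos_eigenvalues (sym3 a b c d e f) \<le> 1"
  shows "a * d \<le> b\<^sup>2"
    and "a * (d * f - e\<^sup>2) - b * (b * f - c * e) + c * (b * e - c * d) \<ge> 0"
proof -
  let ?p = "char_poly (sym3 a b c d e f)"
  define R where "R = sqrt ((a - d)\<^sup>2 + 4 * b\<^sup>2)"
  \<comment> \<open>The eigenvalues of the leading block of order two.\<close>
  define k1 where "k1 = (a + d + R) / 2"
  define k2 where "k2 = (a + d - R) / 2"
  have R2: "R\<^sup>2 = (a - d)\<^sup>2 + 4 * b\<^sup>2" unfolding R_def by simp
  have "(a - d)\<^sup>2 < R\<^sup>2" using pos unfolding R2 by simp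
  hence Rgt: "\<bar>a - d\<bar> < R" unfolding R_def by (simp add: real_less_rsqrt)
  have k12: "k1 > a" "k2 < a" "k2 < k1" "k1 > 0" using Rgt pos unfolding k1_def k2_def by auto
  have kk: "(k1 - a) * (k1 - d) = b\<^sup>2" "(k2 - a) * (k2 - d) = b\<^sup>2" "k1 * k2 = a * d - b\<^sup>2"
    using R2 unfolding k1_def k2_def by (auto simp: field_simps power2_eq_square)
  have pk: "(k - a) * poly ?p k = - (b * c + e * (k - a))\<^sup>2" if "(k - a) * (k - d) = b\<^sup>2" for k
  proof -
    have "(k - a) * poly ?p k =
       (k - a) * (k - f) * ((k - a) * (k - d) - b\<^sup>2)
       - (c\<^sup>2 * ((k - a) * (k - d)) + 2 * b * c * e * (k - a) + e\<^sup>2 * (k - a)\<^sup>2)"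
      unfolding char_poly_sym3 by (simp add: algebra_simps power2_eq_square)
    also have "\<dots> = - (b * c + e * (k - a))\<^sup>2"
      unfolding that by (simp add: algebra_simps power2_eq_square)
    finally show ?thesis .
  qed
  have "(k1 - a) * poly ?p k1 \<le> 0" unfolding pk[OF kk(1)] by simp
  hence p1: "poly ?p k1 \<le> 0" using k12 by (simp add: mult_le_0_iff)
  have "(k2 - a) * poly ?p k2 \<le> 0" unfolding pk[OF kk(2)] by simp
  hence p2: "poly ?p k2 \<ge> 0" using k12 by (simp add: mult_le_0_iff)
  have lc: "lead_coeff ?p > 0" unfolding char_poly_sym3 by simp
  show "a * d \<le> b\<^sup>2"
  proof (rule ccontr)
    assume "\<not> ?thesis"
    hence "k1 * k2 > 0" using kk by simp
    hence "k2 > 0" using k12 by (simp add: zero_less_mult_iff)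
    thus False
      using two_positive_roots[OF lc p1, of k2] p2 k12 one by (simp add: num_pos_eigenvalues_def)
  qed
  show "a * (d * f - e\<^sup>2) - b * (b * f - c * e) + c * (b * e - c * d) \<ge> 0"
  proof (rule ccontr)
    assume "\<not> ?thesis"
    hence "poly ?p 0 > 0" unfolding char_poly_sym3 by simp
    thus False
      using two_positive_roots[OF lc p1, of 0] k12 one by (simp add: num_pos_eigenvalues_def)
  qed
qed

text \<open>Multiplied by $a$, the determinant becomes that of the form of order two which remains after
eliminating the first basis vector; its sign bounds the off-diagonal entry $ae - bc$ of that form.\<close>

lemma sym3_corner_bound:
  assumes pos: "a > 0" "b > 0" "c > 0" "d > 0" "f > 0"
    and one: "num_pos_eigenvalues (sym3 a b c d e f) \<le> 1"
  shows "a * e \<le> 2 * b * c"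
proof -
  have "char_poly (sym3 a c b f e d) = char_poly (sym3 a b c d e f)"
    unfolding char_poly_sym3 by (simp add: algebra_simps)
  hence one': "num_pos_eigenvalues (sym3 a c b f e d) \<le> 1"
    using one by (simp add: num_pos_eigenvalues_def)
  have m: "a * d \<le> b\<^sup>2" "a * f \<le> c\<^sup>2"
    using sym3_one_pos_eigenvalue(1)[OF _ _ _ one] sym3_one_pos_eigenvalue(1)[OF _ _ _ one'] pos by auto
  have "0 \<le> a * (a * (d * f - e\<^sup>2) - b * (b * f - c * e) + c * (b * e - c * d))"
    using sym3_one_pos_eigenvalue(2)[OF _ _ _ one] pos by simp
  also have "\<dots> = (b\<^sup>2 - a * d) * (c\<^sup>2 - a * f) - (a * e - b * c)\<^sup>2"
    by (simp add: algebra_simps power2_eq_square)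
  finally have "(a * e - b * c)\<^sup>2 \<le> (b\<^sup>2 - a * d) * (c\<^sup>2 - a * f)" by simp
  also have "\<dots> \<le> b\<^sup>2 * c\<^sup>2" using m pos by (intro mult_mono) auto
  finally have "(a * e - b * c)\<^sup>2 \<le> (b * c)\<^sup>2" by (simp add: power_mult_distrib)
  hence "a * e - b * c \<le> b * c" by (rule power2_le_imp_le) (use pos in simp)
  thus ?thesis by simp
qed

text \<open>Exchanging the basis vectors, so that any diagonal entry can take the role of the first one.\<close>

lemma num_pos_eigenvalues_sym3_permute:
  "num_pos_eigenvalues (sym3 d b e a c f) = num_pos_eigenvalues (sym3 a b c d e f)"
  "num_pos_eigenvalues (sym3 f c e a b d) = num_pos_eigenvalues (sym3 a b c d e f)"
  unfolding num_pos_eigenvalues_def char_poly_sym3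
  by (rule arg_cong[where f = "\<lambda>p. size {#t \<in># proots p. 0 < t#}"], simp add: algebra_simps power2_eq_square)+

lemma full_support_pos:
  assumes "full_support c" "i + j + k = 3"
  shows "c (i, j, k) > 0"
  using assms by (auto simp: full_support_def Delta33_def)

lemma Phi_diag_le_8:
  assumes "full_support c"
    and "c (3,0,0) * c (1,1,1) \<le> 2 * c (2,1,0) * c (2,0,1)"
    and "c (0,3,0) * c (1,1,1) \<le> 2 * c (1,2,0) * c (0,2,1)"
    and "c (0,0,3) * c (1,1,1) \<le> 2 * c (1,0,2) * c (0,1,2)"
  shows "Phi_diag c \<le> 8"
proof -
  note pos = full_support_pos[OF assms(1)]
  have "(c (3,0,0) * c (1,1,1)) * (c (0,3,0) * c (1,1,1)) * (c (0,0,3) * c (1,1,1))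
     \<le> (2 * c (2,1,0) * c (2,0,1)) * (2 * c (1,2,0) * c (0,2,1)) * (2 * c (1,0,2) * c (0,1,2))"
    by (intro mult_mono assms mult_nonneg_nonneg less_imp_le[OF pos]) auto
  thus ?thesis unfolding Phi_diag_def using pos
    by (subst pos_divide_le_eq) (auto intro!: mult_pos_pos simp: algebra_simps power3_eq_cube)
qed

lemma lorentzian_Phi_diag_le_8:
  assumes "c \<in> lorentzian_cubics"
  shows "Phi_diag c \<le> 8"
proof (rule Phi_diag_le_8)
  show fs: "full_support c" using assms by (simp add: lorentzian_cubics_def)
  note pos = full_support_pos[OF fs]
  have s: "num_pos_eigenvalues (cubic_slice c i) \<le> 1" if "i < 3" for i
    using assms that by (simp add: lorentzian_cubics_def)
  show "c (3,0,0) * c (1,1,1) \<le> 2 * c (2,1,0) * c (2,0,1)"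
    using s[of 0] by (intro sym3_corner_bound) (auto simp: cubic_slice_eq intro!: pos)
  show "c (0,3,0) * c (1,1,1) \<le> 2 * c (1,2,0) * c (0,2,1)"
    using s[of 1] unfolding cubic_slice_eq num_pos_eigenvalues_sym3_permute(1)[symmetric, of "c (2,1,0)"]
    by (intro sym3_corner_bound) (auto intro!: pos)
  show "c (0,0,3) * c (1,1,1) \<le> 2 * c (1,0,2) * c (0,1,2)"
    using s[of 2] unfolding cubic_slice_eq num_pos_eigenvalues_sym3_permute(2)[symmetric, of "c (2,0,1)"]
    by (intro sym3_corner_bound) (auto intro!: pos)
qed

section \<open>The bound for volume polynomials\<close>

lemma Delta33_eq:
  "Delta33 = {(3,0,0), (0,3,0), (0,0,3), (2,1,0), (2,0,1), (1,2,0), (0,2,1), (1,0,2), (0,1,2), (1,1,1)}"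
proof -
  have "Delta33 = (\<Union>i\<in>{..3}. \<Union>j\<in>{..3 - i}. {(i, j, 3 - i - j)})"
    by (auto simp: Delta33_def)
  moreover have "{..3::nat} = {0, 1, 2, 3}" "{..2::nat} = {0, 1, 2}" "{..Suc 0} = {0, 1}" by auto
  ultimately show ?thesis by (simp add: insert_commute)
qed

lemma cubic_eval_expand:
  "cubic_eval c x y z =
     (c (3,0,0) * x^3 + c (0,3,0) * y^3 + c (0,0,3) * z^3
      + 3 * (c (2,1,0) * x\<^sup>2 * y + c (2,0,1) * x\<^sup>2 * z + c (1,2,0) * x * y\<^sup>2
           + c (0,2,1) * y\<^sup>2 * z + c (1,0,2) * x * z\<^sup>2 + c (0,1,2) * y * z\<^sup>2)
      + 6 * c (1,1,1) * x * y * z) / 6"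
  unfolding cubic_eval_def Delta33_eq by (simp add: fact_numeral field_simps)

text \<open>The trace that the Brunn--Minkowski inequality leaves on a volume polynomial.\<close>

definition orthant_log_concave :: "cubic \<Rightarrow> bool" where
  "orthant_log_concave c \<longleftrightarrow>
     (\<forall>x\<ge>0. \<forall>y\<ge>0. \<forall>z\<ge>0. \<forall>x'\<ge>0. \<forall>y'\<ge>0. \<forall>z'\<ge>0.
        cubic_eval c x y z * cubic_eval c x' y' z'
          \<le> (cubic_eval c ((x + x') / 2) ((y + y') / 2) ((z + z') / 2))\<^sup>2)"

text \<open>For $G = \mathrm{Vol}(xK + yP)$ this is Minkowski's inequality $V(K,K,K) V(K,P,P) \le V(K,K,P)^2$. Along
$x = 1$, log-concavity at $y = 0$ would only give $2AC \le 3B^2$. Along the line $x = 1 - ys$ with $s = B/A$,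
which stays in the orthant for small $y \ge 0$, the linear term vanishes and the second-order condition is
exactly $C - B^2/A \le 0$.\<close>

lemma log_concave_binary_cubic:
  fixes A B C D :: real
  defines "G \<equiv> \<lambda>x y. A * x^3 + 3 * B * x\<^sup>2 * y + 3 * C * x * y\<^sup>2 + D * y^3"
  assumes A: "A > 0" and B: "B \<ge> 0"
    and lc: "\<And>x y x' y'. 0 \<le> x \<Longrightarrow> 0 \<le> y \<Longrightarrow> 0 \<le> x' \<Longrightarrow> 0 \<le> y' \<Longrightarrow>
      G x y * G x' y' \<le> (G ((x + x') / 2) ((y + y') / 2))\<^sup>2"
  shows "A * C \<le> B\<^sup>2"
proof -
  define s where "s = B / A"
  define k where "k = C - A * s\<^sup>2"
  define m where "m = 2 * A * s^3 - 3 * C * s + D"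
  have Bs: "B = A * s" using A by (simp add: s_def)
  have s0: "s \<ge> 0" using A B by (simp add: s_def)
  \<comment> \<open>The choice of $s$ removes the term linear in $e$.\<close>
  have G_line: "G (1 - e * s) e = A + 3 * k * e\<^sup>2 + m * e^3" for e
    unfolding G_def k_def m_def Bs by (simp add: algebra_simps power2_eq_square power3_eq_cube)
  have "\<forall>\<^sub>F e in at_right 0. 6 * A * k \<le> (3 * k + m * e)\<^sup>2 * e\<^sup>2 - 6 * A * m * e"
  proof (rule eventually_at_rightI)
    fix e :: real assume e: "e \<in> {0<..<1 / (2 * s + 1)}"
    hence "e * (2 * s + 1) < 1" using s0 by (auto simp: field_simps)
    hence es: "2 * e * s \<le> 1" using e by (simp add: algebra_simps)
    \<comment> \<open>Log-concavity at $(1, 0)$, its double step $(1 - 2es, 2e)$ and their midpoint.\<close>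
    have "G 1 0 * G (1 - 2 * e * s) (2 * e) \<le> (G ((1 + (1 - 2 * e * s)) / 2) ((0 + 2 * e) / 2))\<^sup>2"
      using e es by (intro lc) auto
    also have "(1 + (1 - 2 * e * s)) / 2 = 1 - e * s" by (simp add: field_simps)
    also have "(0 + 2 * e) / 2 = e" by simp
    also have "G (1 - 2 * e * s) (2 * e) = A + 3 * k * (2 * e)\<^sup>2 + m * (2 * e)^3"
      using G_line[of "2 * e"] by simp
    also have "G 1 0 = A" by (simp add: G_def)
    finally have "A * (A + 3 * k * (2 * e)\<^sup>2 + m * (2 * e)^3) \<le> (A + 3 * k * e\<^sup>2 + m * e^3)\<^sup>2"
      unfolding G_line .
    hence "(6 * A * k) * e\<^sup>2 \<le> ((3 * k + m * e)\<^sup>2 * e\<^sup>2 - 6 * A * m * e) * e\<^sup>2"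
      by (simp add: algebra_simps power2_eq_square power3_eq_cube)
    thus "6 * A * k \<le> (3 * k + m * e)\<^sup>2 * e\<^sup>2 - 6 * A * m * e"
      by (rule mult_right_le_imp_le) (use e in auto)
  qed (use s0 in auto)
  moreover have "((\<lambda>e. (3 * k + m * e)\<^sup>2 * e\<^sup>2 - 6 * A * m * e) \<longlongrightarrow> (3 * k + m * 0)\<^sup>2 * 0\<^sup>2 - 6 * A * m * 0) (at_right 0)"
    by (intro tendsto_intros)
  ultimately have "6 * A * k \<le> (3 * k + m * 0)\<^sup>2 * 0\<^sup>2 - 6 * A * m * 0"
    by (intro tendsto_lowerbound[of _ _ "at_right (0::real)"]) auto
  hence "6 * (A * k) \<le> 0" by simp
  thus ?thesis by (simp add: k_def Bs algebra_simps power2_eq_square)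
qed

text \<open>The direction $(c_{201}, c_{210})$ balances the two mixed volumes with two copies of the first body;
the middle coefficient is then $2uv$, and the mixed term of $C$ alone gives the bound.\<close>

lemma log_concave_corner_bound:
  assumes fs: "full_support c" and lc: "orthant_log_concave c"
  shows "c (3,0,0) * c (1,1,1) \<le> 2 * c (2,1,0) * c (2,0,1)"
proof -
  note pos = full_support_pos[OF fs]
  \<comment> \<open>The body $P = u K_2 + v K_3$, whose mixed volume with two copies of the first body is $2uv$.\<close>
  define u where "u = c (2,0,1)"
  define v where "v = c (2,1,0)"
  have uv: "u > 0" "v > 0" using pos by (simp_all add: u_def v_def)
  define C where "C = u\<^sup>2 * c (1,2,0) + 2 * u * v * c (1,1,1) + v\<^sup>2 * c (1,0,2)"
  define D where "D = u^3 * c (0,3,0) + 3 * u\<^sup>2 * v * c (0,2,1) + 3 * u * v\<^sup>2 * c (0,1,2) + v^3 * c (0,0,3)"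
  have E: "c (3,0,0) * x^3 + 3 * (2 * u * v) * x\<^sup>2 * y + 3 * C * x * y\<^sup>2 + D * y^3 = 6 * cubic_eval c x (u * y) (v * y)" for x y
    unfolding cubic_eval_expand C_def D_def by (simp add: u_def v_def algebra_simps power2_eq_square power3_eq_cube)
  have "c (3,0,0) * C \<le> (2 * u * v)\<^sup>2"
  proof (rule log_concave_binary_cubic)
    fix x y x' y' :: real assume nn: "0 \<le> x" "0 \<le> y" "0 \<le> x'" "0 \<le> y'"
    have "cubic_eval c x (u * y) (v * y) * cubic_eval c x' (u * y') (v * y')
      \<le> (cubic_eval c ((x + x') / 2) ((u * y + u * y') / 2) ((v * y + v * y') / 2))\<^sup>2"
      using nn uv lc unfolding orthant_log_concave_def by simp
    also have "(u * y + u * y') / 2 = u * ((y + y') / 2)" by (simp add: algebra_simps)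
    also have "(v * y + v * y') / 2 = v * ((y + y') / 2)" by (simp add: algebra_simps)
    finally show "(c (3,0,0) * x^3 + 3 * (2 * u * v) * x\<^sup>2 * y + 3 * C * x * y\<^sup>2 + D * y^3)
        * (c (3,0,0) * x'^3 + 3 * (2 * u * v) * x'\<^sup>2 * y' + 3 * C * x' * y'\<^sup>2 + D * y'^3)
      \<le> (c (3,0,0) * ((x + x') / 2)^3 + 3 * (2 * u * v) * ((x + x') / 2)\<^sup>2 * ((y + y') / 2)
          + 3 * C * ((x + x') / 2) * ((y + y') / 2)\<^sup>2 + D * ((y + y') / 2)^3)\<^sup>2"
      unfolding E by (simp add: power_mult_distrib)
  qed (use uv pos in auto)
  moreover have "2 * u * v * c (1,1,1) \<le> C"
    using uv pos by (simp add: C_def less_imp_le)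
  hence "c (3,0,0) * (2 * u * v * c (1,1,1)) \<le> c (3,0,0) * C"
    using pos[of 3 0 0] by (intro mult_left_mono) auto
  ultimately have "c (3,0,0) * (2 * u * v * c (1,1,1)) \<le> (2 * u * v)\<^sup>2" by linarith
  hence "(c (3,0,0) * c (1,1,1)) * (2 * u * v) \<le> (2 * u * v) * (2 * u * v)"
    by (simp add: power2_eq_square mult_ac)
  hence "c (3,0,0) * c (1,1,1) \<le> 2 * u * v" by (rule mult_right_le_imp_le) (use uv in simp)
  thus ?thesis by (simp add: u_def v_def mult_ac)
qed

text \<open>The corner bound for the other two variables comes from exchanging variables.\<close>

lemma log_concave_Phi_diag_le_8:
  assumes fs: "full_support c" and lc: "orthant_log_concave c"
  shows "Phi_diag c \<le> 8"
proof (rule Phi_diag_le_8[OF fs])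
  note pos = full_support_pos[OF fs]
  show "c (3,0,0) * c (1,1,1) \<le> 2 * c (2,1,0) * c (2,0,1)"
    by (rule log_concave_corner_bound[OF fs lc])
  define c1 where "c1 = (\<lambda>(i, j, k). c (j, i, k))"
  have "cubic_eval c1 x y z = cubic_eval c y x z" for x y z
    unfolding cubic_eval_expand c1_def by (simp add: algebra_simps)
  hence "orthant_log_concave c1" "full_support c1"
    using lc fs by (auto simp: orthant_log_concave_def full_support_def Delta33_def c1_def)
  from log_concave_corner_bound[OF this(2,1)]
  show "c (0,3,0) * c (1,1,1) \<le> 2 * c (1,2,0) * c (0,2,1)" by (simp add: c1_def)
  define c2 where "c2 = (\<lambda>(i, j, k). c (k, j, i))"
  have "cubic_eval c2 x y z = cubic_eval c z y x" for x y z
    unfolding cubic_eval_expand c2_def by (simp add: algebra_simps)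
  hence "orthant_log_concave c2" "full_support c2"
    using lc fs by (auto simp: orthant_log_concave_def full_support_def Delta33_def c2_def)
  from log_concave_corner_bound[OF this(2,1)]
  show "c (0,0,3) * c (1,1,1) \<le> 2 * c (1,0,2) * c (0,1,2)" by (simp add: c2_def mult_ac)
qed

text \<open>Convexity is what makes $xK + x'K$ equal to $(x + x')K$.\<close>

lemma convex_scaled_sum:
  fixes K :: "'a::real_vector set"
  assumes "convex K" "k \<in> K" "k' \<in> K" "0 \<le> x" "0 \<le> x'"
  shows "(1/2) *\<^sub>R (x *\<^sub>R k + x' *\<^sub>R k') \<in> (*\<^sub>R) ((x + x') / 2) ` K"
proof (cases "x + x' = 0")
  case True
  hence "x = 0" "x' = 0" using assms(4,5) by auto
  thus ?thesis using assms(2) by (auto intro!: image_eqI[of _ _ k])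
next
  case False
  hence p: "x + x' > 0" using assms by simp
  define m where "m = (x / (x + x')) *\<^sub>R k + (x' / (x + x')) *\<^sub>R k'"
  have "m \<in> K" unfolding m_def
    by (rule convexD[OF assms(1-3)]) (use assms(4,5) p in \<open>auto simp: add_divide_distrib[symmetric]\<close>)
  moreover have "(1/2) *\<^sub>R (x *\<^sub>R k + x' *\<^sub>R k') = ((x + x') / 2) *\<^sub>R m"
  proof -
    have *: "(x + x') / 2 * (x / (x + x')) = x / 2" "(x + x') / 2 * (x' / (x + x')) = x' / 2"
      using p by (simp_all add: divide_simps)
    show ?thesis unfolding m_def scaleR_add_right scaleR_scaleR * by simp
  qed
  ultimately show ?thesis by blast
qed

lemma compact_set_plus:
  fixes S T :: "'a::real_normed_vector set"
  assumes "compact S" "compact T"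
  shows "compact (S + T)"
proof -
  have "S + T = {x + y |x y. x \<in> S \<and> y \<in> T}" by (auto simp: set_plus_def)
  thus ?thesis using compact_sums[OF assms] by simp
qed

lemma volume_polynomial_log_concave:
  assumes K: "convex_body K1" "convex_body K2" "convex_body K3"
    and vol: "is_volume_polynomial c K1 K2 K3"
  shows "orthant_log_concave c"
  unfolding orthant_log_concave_def
proof (intro allI impI)
  fix x y z x' y' z' :: real
  assume nn: "0 \<le> x" "0 \<le> y" "0 \<le> z" "0 \<le> x'" "0 \<le> y'" "0 \<le> z'"
  define S where "S x y z = (*\<^sub>R) x ` K1 + (*\<^sub>R) y ` K2 + (*\<^sub>R) z ` K3" for x y z :: real
  have cpt: "compact (S x y z)" for x y z
    unfolding S_def using K by (intro compact_set_plus compact_scaling) (auto simp: convex_body_def)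
  have cv: "convex K1" "convex K2" "convex K3" using K by (auto simp: convex_body_def)
  have E: "cubic_eval c x y z = measure lebesgue (S x y z)" if "0 \<le> x" "0 \<le> y" "0 \<le> z" for x y z
    using vol that by (simp add: is_volume_polynomial_def S_def)
  have "measure lebesgue (S x y z) * measure lebesgue (S x' y' z')
     \<le> (measure lebesgue (S ((x + x') / 2) ((y + y') / 2) ((z + z') / 2)))\<^sup>2"
  proof (rule multiplicative_brunn_minkowski[OF cpt cpt cpt])
    fix p q assume "p \<in> S x y z" "q \<in> S x' y' z'"
    then obtain k1 k2 k3 l1 l2 l3 where kl: "k1 \<in> K1" "k2 \<in> K2" "k3 \<in> K3" "l1 \<in> K1" "l2 \<in> K2" "l3 \<in> K3"
      and p: "p = x *\<^sub>R k1 + y *\<^sub>R k2 + z *\<^sub>R k3" and q: "q = x' *\<^sub>R l1 + y' *\<^sub>R l2 + z' *\<^sub>R l3"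
      unfolding S_def by (auto elim!: set_plus_elim)
    have "(1/2) *\<^sub>R (p + q) = (1/2) *\<^sub>R (x *\<^sub>R k1 + x' *\<^sub>R l1) + (1/2) *\<^sub>R (y *\<^sub>R k2 + y' *\<^sub>R l2)
       + (1/2) *\<^sub>R (z *\<^sub>R k3 + z' *\<^sub>R l3)"
      unfolding p q by (simp add: algebra_simps)
    also have "\<dots> \<in> S ((x + x') / 2) ((y + y') / 2) ((z + z') / 2)"
      unfolding S_def by (intro set_plus_intro convex_scaled_sum cv kl nn)
    finally show "(1/2) *\<^sub>R (p + q) \<in> S ((x + x') / 2) ((y + y') / 2) ((z + z') / 2)" .
  qed
  thus "cubic_eval c x y z * cubic_eval c x' y' z'
          \<le> (cubic_eval c ((x + x') / 2) ((y + y') / 2) ((z + z') / 2))\<^sup>2"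
    using nn by (simp add: E)
qed

lemma volume_Phi_diag_le_8:
  assumes "c \<in> volume_cubics"
  shows "Phi_diag c \<le> 8"
  using assms unfolding volume_cubics_def
  by (auto intro!: log_concave_Phi_diag_le_8 intro: volume_polynomial_log_concave)

section \<open>Minkowski sums of three pyramids\<close>

text \<open>Points are listed as $(x, z, y)$: the integration over $y$ comes first, since all
three pyramids lie over the plane $y = 0$ and each of their $y$-fibres starts there. The unit square in
the plane $z = 0$ is the base and $(0,0,1)$ the apex.\<close>

definition pyramid1 :: "(real \<times> real \<times> real) set" where
  "pyramid1 = {(x, z, y). 0 \<le> x \<and> 0 \<le> z \<and> 0 \<le> y \<and> x + z \<le> 1 \<and> y + z \<le> 1}"

text \<open>The base is a rectangle with sides $\varepsilon$ and $\varepsilon^2$ in the plane $x = 0$, and the apex lies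
on the $x$-axis. This pyramid and the next one extend below the plane $z = 0$, the first one above it, so
that their interaction is confined to their faces in this plane.\<close>

definition pyramid2 :: "real \<Rightarrow> (real \<times> real \<times> real) set" where
  "pyramid2 e = {(x, z, y). 0 \<le> x \<and> z \<le> 0 \<and> 0 \<le> y \<and> y \<le> e * (1 - x) \<and> - z \<le> e\<^sup>2 * (1 - x)}"

text \<open>The base lies in the plane $y = 0$ and the apex on the $y$-axis. The side in the direction of $x$ is placed at
$x \le 0$, opposite to the second pyramid.\<close>

definition pyramid3 :: "real \<Rightarrow> (real \<times> real \<times> real) set" where
  "pyramid3 e = {(x, z, y). x \<le> 0 \<and> z \<le> 0 \<and> 0 \<le> y \<and> - x \<le> e * (1 - y) \<and> - z \<le> e\<^sup>2 * (1 - y)}"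

lemma scaleR_image_pos:
  fixes S :: "'a::real_vector set"
  assumes "a > 0"
  shows "(*\<^sub>R) a ` S = {p. (1 / a) *\<^sub>R p \<in> S}"
proof (intro equalityI subsetI)
  fix p assume "p \<in> {p. (1 / a) *\<^sub>R p \<in> S}"
  thus "p \<in> (*\<^sub>R) a ` S" using assms by (intro image_eqI[of _ _ "(1 / a) *\<^sub>R p"]) auto
qed (use assms in auto)

lemma scaleR_pyramid1:
  assumes "0 \<le> a"
  shows "(*\<^sub>R) a ` pyramid1 = {(x, z, y). 0 \<le> x \<and> 0 \<le> z \<and> 0 \<le> y \<and> x + z \<le> a \<and> y + z \<le> a}"
proof (cases "a = 0")
  case True
  have "(0, 0, 0) \<in> pyramid1" by (simp add: pyramid1_def)
  thus ?thesis using True by (auto simp: zero_prod_def intro!: image_eqI[of _ _ "(0,0,0)"])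
next
  case False
  hence "a > 0" using assms by simp
  thus ?thesis unfolding scaleR_image_pos[OF \<open>a > 0\<close>] pyramid1_def
    by (auto simp: zero_le_divide_iff add_divide_distrib[symmetric])
qed

lemma scaleR_pyramid2:
  assumes "0 \<le> b" and e: "e > 0"
  shows "(*\<^sub>R) b ` pyramid2 e =
    {(x, z, y). 0 \<le> x \<and> z \<le> 0 \<and> 0 \<le> y \<and> y \<le> e * (b - x) \<and> - z \<le> e\<^sup>2 * (b - x)}" (is "_ = ?R")
proof (cases "b = 0")
  case True
  have "(0, 0, 0) \<in> pyramid2 e" using e by (simp add: pyramid2_def)
  moreover have "x = 0 \<and> z = 0 \<and> y = 0"
    if *: "0 \<le> x" "z \<le> 0" "0 \<le> y" "y \<le> e * (b - x)" "- z \<le> e\<^sup>2 * (b - x)" for x y z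
  proof -
    have "0 \<le> e * (b - x)" using * by linarith
    hence "x = 0" using True * e by (simp add: mult_le_0_iff)
    thus ?thesis using True * by auto
  qed
  hence "?R \<subseteq> {(0, 0, 0)}" by auto
  moreover have "(0, 0, 0) \<in> ?R" using True by simp
  ultimately show ?thesis using True by (auto simp: zero_prod_def intro!: image_eqI[of _ _ "(0,0,0)"])
next
  case False
  hence b: "b > 0" using assms by simp
  have "y / b \<le> k * (1 - x / b) \<longleftrightarrow> y \<le> k * (b - x)" for k x y
  proof -
    have "k * (1 - x / b) = k * (b - x) / b" using b by (simp add: field_simps)
    thus ?thesis using b by (simp add: divide_le_cancel)
  qed
  from this[of _ e] this[of "- _" "e\<^sup>2"] show ?thesis
    unfolding scaleR_image_pos[OF b] pyramid2_def
    using b by (auto simp: zero_le_divide_iff divide_le_0_iff)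
qed

text \<open>A quarter turn about the $z$-axis takes the second pyramid to the third.\<close>

lemma scaleR_pyramid3:
  assumes "0 \<le> c" and e: "e > 0"
  shows "(*\<^sub>R) c ` pyramid3 e =
    {(x, z, y). x \<le> 0 \<and> z \<le> 0 \<and> 0 \<le> y \<and> - x \<le> e * (c - y) \<and> - z \<le> e\<^sup>2 * (c - y)}" (is "_ = ?R")
proof -
  let ?r = "\<lambda>(x, z, y). (- y, z, x) :: real \<times> real \<times> real"
  have r: "?r ` S = {(x, z, y). (y, z, - x) \<in> S}" for S
  proof (intro equalityI subsetI)
    fix p assume "p \<in> {(x, z, y). (y, z, - x) \<in> S}"
    thus "p \<in> ?r ` S" by (intro image_eqI[of _ _ "(snd (snd p), fst (snd p), - fst p)"]) auto
  qed auto
  have p3: "pyramid3 e = ?r ` pyramid2 e"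
    unfolding r by (auto simp: pyramid2_def pyramid3_def)
  have "(*\<^sub>R) c ` pyramid3 e = ?r ` ((*\<^sub>R) c ` pyramid2 e)"
    unfolding p3 image_image by (intro image_cong) auto
  also have "\<dots> = ?R"
    unfolding r scaleR_pyramid2[OF assms] by auto
  finally show ?thesis .
qed

text \<open>Here $s$, $w$ and $r$ are the sizes that remain of the three scaled pyramids at the position $(x, z)$:
the first is used up by height above $z = 0$, the second by the part of $x$ beyond $s$, the third by
negative $x$. The depth below $z = 0$, in units of $\varepsilon^2$, is $t$; the second pyramid provides up
to $w$ of it at no cost, and any excess is taken from the $y$-extent of the third.\<close>

definition pyramid_sum :: "real \<Rightarrow> real \<Rightarrow> real \<Rightarrow> real \<Rightarrow> (real \<times> real \<times> real) set" where
  "pyramid_sum e a b c = {(x, z, y).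
     let s = a - max 0 z; t = max 0 (- z) / e\<^sup>2; w = b - max 0 (x - s); r = c - max 0 (- x) / e
     in 0 \<le> s \<and> 0 \<le> w \<and> 0 \<le> r \<and> t \<le> w + c \<and> 0 \<le> y \<and> y \<le> s + e * w + min r (c + w - t)}"

lemma pyramid_sum_iff:
  assumes "s = a - max 0 z" "t = max 0 (- z) / e\<^sup>2" "w = b - max 0 (x - s)" "r = c - max 0 (- x) / e"
  shows "(x, z, y) \<in> pyramid_sum e a b c \<longleftrightarrow>
    0 \<le> s \<and> 0 \<le> w \<and> 0 \<le> r \<and> t \<le> w + c \<and> 0 \<le> y \<and> y \<le> s + e * w + min r (c + w - t)"
  unfolding pyramid_sum_def Let_def assms by (simp only: mem_Collect_eq prod.case)

text \<open>A point on the right is decomposed greedily: height above $z = 0$ is taken from the first pyramid, depth below it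
from the second and then the third, positive $x$ from the first and then the second, negative $x$ from the
third.\<close>

lemma Minkowski_sum_pyramids:
  assumes abc: "0 \<le> a" "0 \<le> b" "0 \<le> c" and e: "e > 0"
  shows "(*\<^sub>R) a ` pyramid1 + (*\<^sub>R) b ` pyramid2 e + (*\<^sub>R) c ` pyramid3 e = pyramid_sum e a b c"
proof (intro equalityI subsetI)
  fix p assume "p \<in> (*\<^sub>R) a ` pyramid1 + (*\<^sub>R) b ` pyramid2 e + (*\<^sub>R) c ` pyramid3 e"
  then obtain x1 z1 y1 x2 z2 y2 x3 z3 y3
    where p: "p = (x1 + x2 + x3, z1 + z2 + z3, y1 + y2 + y3)"
      and 1: "0 \<le> x1" "0 \<le> z1" "0 \<le> y1" "x1 + z1 \<le> a" "y1 + z1 \<le> a"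
      and 2: "0 \<le> x2" "z2 \<le> 0" "0 \<le> y2" "y2 \<le> e * (b - x2)" "- z2 \<le> e\<^sup>2 * (b - x2)"
      and 3: "x3 \<le> 0" "z3 \<le> 0" "0 \<le> y3" "- x3 \<le> e * (c - y3)" "- z3 \<le> e\<^sup>2 * (c - y3)"
    unfolding scaleR_pyramid1[OF abc(1)] scaleR_pyramid2[OF abc(2) e] scaleR_pyramid3[OF abc(3) e]
    by (auto simp: set_plus_def)
  define X Y Z where XYZ: "X = x1 + x2 + x3" "Y = y1 + y2 + y3" "Z = z1 + z2 + z3"
  define s where "s = a - max 0 Z"
  define t where "t = max 0 (- Z) / e\<^sup>2"
  define w where "w = b - max 0 (X - s)"
  define r where "r = c - max 0 (- X) / e"
  have s: "a - z1 \<le> s" unfolding s_def using 1 2 3 XYZ by auto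
  have bx: "0 \<le> b - x2"
  proof -
    have "0 \<le> e * (b - x2)" using 2 by linarith
    thus ?thesis using e by (simp add: zero_le_mult_iff)
  qed
  have cy: "0 \<le> c - y3"
  proof -
    have "0 \<le> e * (c - y3)" using 3 by linarith
    thus ?thesis using e by (simp add: zero_le_mult_iff)
  qed
  have w: "b - x2 \<le> w" unfolding w_def using s 1 2 3 XYZ by auto
  have "max 0 (- X) \<le> e * (c - y3)" using 1 2 3 XYZ by auto
  hence "max 0 (- X) / e \<le> c - y3" using e by (simp add: pos_divide_le_eq mult.commute)
  hence r: "y3 \<le> r" unfolding r_def by linarith
  have "max 0 (- Z) \<le> e\<^sup>2 * (b - x2) + e\<^sup>2 * (c - y3)" using 1 2 3 XYZ by auto
  also have "\<dots> = (b - x2 + (c - y3)) * e\<^sup>2" by (simp add: algebra_simps)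
  finally have t: "t \<le> b - x2 + (c - y3)" unfolding t_def using e by (simp add: pos_divide_le_eq)
  have "e * (b - x2) \<le> e * w" using w e by simp
  hence y: "Y \<le> s + e * w + min r (c + w - t)" using 1 2 3 s r t w XYZ by (auto simp: min_def)
  have "0 \<le> s" "0 \<le> w" "0 \<le> r" "t \<le> w + c" "0 \<le> Y"
    using 1 2 3 s bx cy w r t XYZ by linarith+
  moreover have "p = (X, Z, Y)" unfolding p XYZ ..
  ultimately show "p \<in> pyramid_sum e a b c"
    using y pyramid_sum_iff[OF s_def t_def w_def r_def] by blast
next
  fix p assume "p \<in> pyramid_sum e a b c"
  obtain x z y where p: "p = (x, z, y)" by (cases p)
  define s where "s = a - max 0 z"
  define t where "t = max 0 (- z) / e\<^sup>2"
  define w where "w = b - max 0 (x - s)"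
  define r where "r = c - max 0 (- x) / e"
  have h: "0 \<le> s" "0 \<le> w" "0 \<le> r" "t \<le> w + c" "0 \<le> y" "y \<le> s + e * w + min r (c + w - t)"
    using \<open>p \<in> pyramid_sum e a b c\<close> pyramid_sum_iff[OF s_def t_def w_def r_def] unfolding p by blast+
  have t0: "0 \<le> t" by (simp add: t_def)
  define y3 where "y3 = min y (min r (c + w - t))"
  define y1 where "y1 = min (y - y3) s"
  define t2 where "t2 = min w t"
  have ez: "e\<^sup>2 * t = max 0 (- z)" using e by (simp add: t_def)
  have er: "e * (c - r) = max 0 (- x)" using e by (simp add: r_def)
  have ew: "0 \<le> e * w" using e h by simp
  have rc: "r \<le> c" using e by (simp add: r_def)
  have y3: "0 \<le> y3" "y3 \<le> r" "y3 \<le> c + w - t" "y3 \<le> y" using h by (auto simp: y3_def)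
  have yy: "y - y3 \<le> s + e * w" using h ew by (auto simp: y3_def)
  have "(max 0 (min x s), max 0 z, y1) \<in> (*\<^sub>R) a ` pyramid1"
    unfolding scaleR_pyramid1[OF abc(1)] using h y3 by (auto simp: s_def y1_def)
  moreover have "(max 0 (x - s), - (e\<^sup>2 * t2), y - y3 - y1) \<in> (*\<^sub>R) b ` pyramid2 e"
  proof -
    have "b - max 0 (x - s) = w" by (simp add: w_def)
    moreover have "e\<^sup>2 * t2 \<le> e\<^sup>2 * w" by (intro mult_left_mono) (auto simp: t2_def)
    moreover have "0 \<le> e\<^sup>2 * t2" using h t0 by (simp add: t2_def)
    moreover have "y - y3 - y1 \<le> e * w" "0 \<le> y - y3 - y1" using yy ew by (auto simp: y1_def)
    ultimately show ?thesis unfolding scaleR_pyramid2[OF abc(2) e] by simp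
  qed
  moreover have "(min x 0, - (e\<^sup>2 * (t - t2)), y3) \<in> (*\<^sub>R) c ` pyramid3 e"
  proof -
    have "e * (c - r) \<le> e * (c - y3)" using y3 e by simp
    hence "- min x 0 \<le> e * (c - y3)" unfolding er by auto
    moreover have "e\<^sup>2 * (t - t2) \<le> e\<^sup>2 * (c - y3)"
      using y3 rc by (intro mult_left_mono) (auto simp: t2_def)
    moreover have "0 \<le> e\<^sup>2 * (t - t2)" by (simp add: t2_def)
    ultimately show ?thesis unfolding scaleR_pyramid3[OF abc(3) e] using y3 by simp
  qed
  ultimately have "(max 0 (min x s), max 0 z, y1) + (max 0 (x - s), - (e\<^sup>2 * t2), y - y3 - y1)
      + (min x 0, - (e\<^sup>2 * (t - t2)), y3) \<in> (*\<^sub>R) a ` pyramid1 + (*\<^sub>R) b ` pyramid2 e + (*\<^sub>R) c ` pyramid3 e"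
    by (intro set_plus_intro)
  also have "(max 0 (min x s), max 0 z, y1) + (max 0 (x - s), - (e\<^sup>2 * t2), y - y3 - y1)
      + (min x 0, - (e\<^sup>2 * (t - t2)), y3) = p"
  proof -
    have "max 0 (min x s) + max 0 (x - s) + min x 0 = x" using h(1) by auto
    moreover have "max 0 z + - (e\<^sup>2 * t2) + - (e\<^sup>2 * (t - t2)) = z"
      using ez by (auto simp: right_diff_distrib)
    ultimately show ?thesis unfolding p by simp
  qed
  finally show "p \<in> (*\<^sub>R) a ` pyramid1 + (*\<^sub>R) b ` pyramid2 e + (*\<^sub>R) c ` pyramid3 e" .
qed

section \<open>The volume of the sum of the pyramids\<close>

lemma nn_integral_split_at:
  fixes f :: "real \<Rightarrow> ennreal" and m :: real
  assumes [measurable]: "f \<in> borel_measurable borel"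
  shows "(\<integral>\<^sup>+x. f x \<partial>lborel) = (\<integral>\<^sup>+x. f x * indicator {..m} x \<partial>lborel) + (\<integral>\<^sup>+x. f x * indicator {m..} x \<partial>lborel)"
proof -
  have "(\<integral>\<^sup>+x. f x \<partial>lborel) = (\<integral>\<^sup>+x. f x * indicator {..m} x + f x * indicator {m..} x \<partial>lborel)"
    by (rule nn_integral_cong_AE, use AE_lborel_singleton[of m] in eventually_elim)
       (auto simp: indicator_def)
  also have "\<dots> = (\<integral>\<^sup>+x. f x * indicator {..m} x \<partial>lborel) + (\<integral>\<^sup>+x. f x * indicator {m..} x \<partial>lborel)"
    by (rule nn_integral_add) measurable
  finally show ?thesis .
qed

lemma nn_integral_Icc_split:
  fixes f :: "real \<Rightarrow> ennreal" and m :: real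
  assumes [measurable]: "f \<in> borel_measurable borel" and "l \<le> m" "m \<le> u"
  shows "(\<integral>\<^sup>+x. f x * indicator {l..u} x \<partial>lborel)
    = (\<integral>\<^sup>+x. f x * indicator {l..m} x \<partial>lborel) + (\<integral>\<^sup>+x. f x * indicator {m..u} x \<partial>lborel)"
proof -
  have "(\<lambda>x. f x * indicator {l..u} x * indicator {..m} x) = (\<lambda>x. f x * indicator {l..m} x)"
       "(\<lambda>x. f x * indicator {l..u} x * indicator {m..} x) = (\<lambda>x. f x * indicator {m..u} x)"
    using assms by (auto simp: indicator_def fun_eq_iff)
  thus ?thesis by (subst nn_integral_split_at[of _ m]) (simp_all only:, measurable)
qed

lemma nn_integral_FTC_cong:
  fixes g :: "real \<Rightarrow> real"
  assumes "\<And>x. l \<le> x \<Longrightarrow> x \<le> u \<Longrightarrow> g x = f x" "f \<in> borel_measurable borel"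
    and "\<And>x. l \<le> x \<Longrightarrow> x \<le> u \<Longrightarrow> (F has_real_derivative f x) (at x)"
    and "\<And>x. l \<le> x \<Longrightarrow> x \<le> u \<Longrightarrow> 0 \<le> f x" "l \<le> u"
  shows "(\<integral>\<^sup>+x. ennreal (g x) * indicator {l..u} x \<partial>lborel) = ennreal (F u - F l)"
proof -
  have "(\<integral>\<^sup>+x. ennreal (g x) * indicator {l..u} x \<partial>lborel) = (\<integral>\<^sup>+x. ennreal (f x) * indicator {l..u} x \<partial>lborel)"
    by (intro nn_integral_cong) (auto simp: indicator_def assms(1))
  also have "\<dots> = ennreal (F u - F l)"
    by (rule nn_integral_FTC_Icc) (use assms in auto)
  finally show ?thesis .
qed

lemma FTC_increment_nonneg:
  fixes f F :: "real \<Rightarrow> real"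
  assumes "\<And>x. l \<le> x \<Longrightarrow> x \<le> u \<Longrightarrow> (F has_real_derivative f x) (at x)"
    and "\<And>x. l \<le> x \<Longrightarrow> x \<le> u \<Longrightarrow> 0 \<le> f x" "l \<le> u"
  shows "F l \<le> F u"
  using assms by (intro DERIV_nonneg_imp_nondecreasing[of l u F]) auto

text \<open>As $x$ runs from left to right, first $r$ grows from 0 to $c$, then both sizes are constant on an
interval of length $s$, and finally $w$ falls from $b$ to 0. A quadratic polynomial in $w$ and $r$
covers the integrands of both halves of the volume computation.\<close>

lemma nn_integral_broken_profile:
  fixes k0 k1 k2 k3 k4 k5 :: real
  defines "\<phi> \<equiv> \<lambda>w r. k0 + k1 * w + k2 * r + k3 * w\<^sup>2 + k4 * r\<^sup>2 + k5 * w * r"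
  assumes s: "0 \<le> s" and b: "0 \<le> b" and c: "0 \<le> c" and e: "0 < e"
    and nn: "\<And>w r. 0 \<le> w \<Longrightarrow> w \<le> b \<Longrightarrow> 0 \<le> r \<Longrightarrow> r \<le> c \<Longrightarrow> 0 \<le> \<phi> w r"
  shows "(\<integral>\<^sup>+x. ennreal (\<phi> (b - max 0 (x - s)) (c - max 0 (- x) / e)) * indicator {- (e * c)..s + b} x \<partial>lborel)
    = ennreal (e * ((k0 + k1 * b + k3 * b\<^sup>2) * c + (k2 + k5 * b) * c\<^sup>2 / 2 + k4 * c^3 / 3)
        + s * \<phi> b c
        + ((k0 + k2 * c + k4 * c\<^sup>2) * b + (k1 + k5 * c) * b\<^sup>2 / 2 + k3 * b^3 / 3))"
proof -
  let ?f = "\<lambda>x. \<phi> (b - max 0 (x - s)) (c - max 0 (- x) / e)"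
  define G1 where "G1 r = (k0 + k1 * b + k3 * b\<^sup>2) * r + (k2 + k5 * b) * r\<^sup>2 / 2 + k4 * r^3 / 3" for r
  define G2 where "G2 w = (k0 + k2 * c + k4 * c\<^sup>2) * w + (k1 + k5 * c) * w\<^sup>2 / 2 + k3 * w^3 / 3" for w
  have d1: "(G1 has_real_derivative \<phi> b r) (at r)" for r
    unfolding G1_def \<phi>_def by (auto intro!: derivative_eq_intros simp: algebra_simps power2_eq_square)
  have d2: "(G2 has_real_derivative \<phi> w c) (at w)" for w
    unfolding G2_def \<phi>_def by (auto intro!: derivative_eq_intros simp: algebra_simps power2_eq_square)
  have m[measurable]: "?f \<in> borel_measurable borel" unfolding \<phi>_def by measurable
  have ec: "0 \<le> e * c" using e c by simp
  have I1: "(\<integral>\<^sup>+x. ennreal (?f x) * indicator {- (e * c)..0} x \<partial>lborel) = ennreal (e * G1 c)"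
  proof -
    have "(\<integral>\<^sup>+x. ennreal (?f x) * indicator {- (e * c)..0} x \<partial>lborel)
      = ennreal (e * G1 (c + 0 / e) - e * G1 (c + - (e * c) / e))"
    proof (rule nn_integral_FTC_cong[where f = "\<lambda>x. \<phi> b (c + x / e)" and F = "\<lambda>x. e * G1 (c + x / e)"])
      fix x assume x: "- (e * c) \<le> x" "x \<le> 0"
      show "?f x = \<phi> b (c + x / e)" using x s by simp
      show "((\<lambda>x. e * G1 (c + x / e)) has_real_derivative \<phi> b (c + x / e)) (at x)"
        using e by (auto intro!: derivative_eq_intros DERIV_chain2[OF d1])
      have "0 \<le> c + x / e" using x e by (simp add: field_simps)
      moreover have "c + x / e \<le> c" using x e by (simp add: divide_le_0_iff)
      ultimately show "0 \<le> \<phi> b (c + x / e)" using b by (intro nn) auto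
    qed (use ec in \<open>auto simp: \<phi>_def\<close>)
    also have "e * G1 (c + 0 / e) - e * G1 (c + - (e * c) / e) = e * G1 c" using e by (simp add: G1_def)
    finally show ?thesis .
  qed
  have I2: "(\<integral>\<^sup>+x. ennreal (?f x) * indicator {0..s} x \<partial>lborel) = ennreal (s * \<phi> b c)"
  proof -
    have "(\<integral>\<^sup>+x. ennreal (?f x) * indicator {0..s} x \<partial>lborel) = ennreal (s * \<phi> b c - 0 * \<phi> b c)"
      by (rule nn_integral_FTC_cong[where f = "\<lambda>x. \<phi> b c" and F = "\<lambda>x. x * \<phi> b c"])
         (use s b c in \<open>auto intro!: derivative_eq_intros nn\<close>)
    thus ?thesis by simp
  qed
  have I3: "(\<integral>\<^sup>+x. ennreal (?f x) * indicator {s..s + b} x \<partial>lborel) = ennreal (G2 b)"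
  proof -
    have "(\<integral>\<^sup>+x. ennreal (?f x) * indicator {s..s + b} x \<partial>lborel)
      = ennreal (- G2 (b - (s + b - s)) - - G2 (b - (s - s)))"
    proof (rule nn_integral_FTC_cong[where f = "\<lambda>x. \<phi> (b - (x - s)) c" and F = "\<lambda>x. - G2 (b - (x - s))"])
      fix x assume x: "s \<le> x" "x \<le> s + b"
      show "?f x = \<phi> (b - (x - s)) c" using x s by simp
      show "((\<lambda>x. - G2 (b - (x - s))) has_real_derivative \<phi> (b - (x - s)) c) (at x)"
        by (auto intro!: derivative_eq_intros DERIV_chain2[OF d2])
      show "0 \<le> \<phi> (b - (x - s)) c" using b c x by (intro nn) auto
    qed (use b in \<open>auto simp: \<phi>_def\<close>)
    also have "- G2 (b - (s + b - s)) - - G2 (b - (s - s)) = G2 b" by (simp add: G2_def)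
    finally show ?thesis .
  qed
  have p1: "0 \<le> G1 c"
    using FTC_increment_nonneg[of 0 c G1 "\<phi> b", OF d1] nn b c by (simp add: G1_def)
  have p2: "0 \<le> G2 b"
    using FTC_increment_nonneg[of 0 b G2 "\<lambda>w. \<phi> w c", OF d2] nn b c by (simp add: G2_def)
  have "(\<integral>\<^sup>+x. ennreal (?f x) * indicator {- (e * c)..s + b} x \<partial>lborel)
    = ennreal (e * G1 c) + (ennreal (s * \<phi> b c) + ennreal (G2 b))"
    using nn_integral_Icc_split[of "\<lambda>x. ennreal (?f x)" "- (e * c)" 0 "s + b"]
      nn_integral_Icc_split[of "\<lambda>x. ennreal (?f x)" 0 s "s + b"] ec s b I1 I2 I3 by simp
  also have "\<dots> = ennreal (e * G1 c + s * \<phi> b c + G2 b)"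
    using p1 p2 e s nn[of b c] b c by (simp add: ennreal_plus[symmetric] del: ennreal_plus)
  finally show ?thesis unfolding G1_def G2_def .
qed

lemma nn_integral_truncated_ramp:
  fixes k r d q :: real
  assumes "0 \<le> k" "0 \<le> r" "r \<le> d" and q: "0 < q"
  shows "(\<integral>\<^sup>+z. ennreal (k + min r (d - max 0 (- z) / q)) * indicator {- (q * d)..0} z \<partial>lborel)
    = ennreal (q * (k * d + r * d - r\<^sup>2 / 2))"
proof -
  let ?f = "\<lambda>z. k + min r (d - max 0 (- z) / q)"
  let ?m = "- (q * (d - r))"
  have ord: "- (q * d) \<le> ?m" "?m \<le> 0" using assms by (auto simp: algebra_simps)
  have "(\<integral>\<^sup>+z. ennreal (?f z) * indicator {?m..0} z \<partial>lborel) = ennreal (0 * (k + r) - ?m * (k + r))"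
  proof (rule nn_integral_FTC_cong[where f = "\<lambda>x. k + r" and F = "\<lambda>x. x * (k + r)"])
    fix z assume z: "?m \<le> z" "z \<le> 0"
    hence "- z / q \<le> q * (d - r) / q" using q by (intro divide_right_mono) auto
    hence "- z / q \<le> d - r" using q by simp
    thus "?f z = k + r" using z by (simp add: min_def)
  qed (use assms ord in \<open>auto intro!: derivative_eq_intros\<close>)
  moreover have "(\<integral>\<^sup>+z. ennreal (?f z) * indicator {- (q * d)..?m} z \<partial>lborel)
     = ennreal (((k + d) * ?m + ?m\<^sup>2 / (2 * q)) - ((k + d) * - (q * d) + (- (q * d))\<^sup>2 / (2 * q)))"
  proof (rule nn_integral_FTC_cong[where f = "\<lambda>x. k + d + x / q" and F = "\<lambda>x. (k + d) * x + x\<^sup>2 / (2 * q)"])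
    fix z assume z: "- (q * d) \<le> z" "z \<le> ?m"
    have z0: "z \<le> 0" using z ord by linarith
    have "q * (d - r) / q \<le> - z / q" using q z by (intro divide_right_mono) auto
    hence "d - r \<le> - z / q" using q by simp
    thus "?f z = k + d + z / q" using z0 by (simp add: min_def)
    show "((\<lambda>x. (k + d) * x + x\<^sup>2 / (2 * q)) has_real_derivative k + d + z / q) (at z)"
      using q by (auto intro!: derivative_eq_intros simp: field_simps)
    have "- z / q \<le> q * d / q" using q z by (intro divide_right_mono) auto
    hence "- z / q \<le> d" using q by simp
    thus "0 \<le> k + d + z / q" using assms by simp
  qed (use ord in auto)
  moreover have "0 \<le> (0 * (k + r) - ?m * (k + r))" using assms by simp
  moreover have e1: "((k + d) * ?m + ?m\<^sup>2 / (2 * q)) - ((k + d) * - (q * d) + (- (q * d))\<^sup>2 / (2 * q))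
      = q * r * (k + r / 2)"
    using q by (simp add: field_simps power2_eq_square)
  moreover have "0 \<le> q * r * (k + r / 2)" using assms by simp
  ultimately have "(\<integral>\<^sup>+z. ennreal (?f z) * indicator {- (q * d)..0} z \<partial>lborel)
    = ennreal (q * r * (k + r / 2) + (0 * (k + r) - ?m * (k + r)))"
    using nn_integral_Icc_split[of "\<lambda>z. ennreal (?f z)" "- (q * d)" ?m 0] ord
    by (simp add: ennreal_plus[symmetric] del: ennreal_plus)
  also have "q * r * (k + r / 2) + (0 * (k + r) - ?m * (k + r)) = q * (k * d + r * d - r\<^sup>2 / 2)"
    by (simp add: algebra_simps power2_eq_square)
  finally show ?thesis .
qed

lemma pyramid_sum_borel: assumes "e > 0" shows "pyramid_sum e a b c \<in> sets borel"
proof -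
  have "closed (pyramid_sum e a b c)"
    unfolding pyramid_sum_def Let_def case_prod_beta
    by (intro closed_Collect_conj closed_Collect_le continuous_intros) (use assms in auto)
  thus ?thesis by (rule borel_closed)
qed

definition pyramid_height :: "real \<Rightarrow> real \<Rightarrow> real \<Rightarrow> real \<Rightarrow> real \<Rightarrow> real \<Rightarrow> ennreal" where
  "pyramid_height e a b c x z = emeasure lborel {y. (x, z, y) \<in> pyramid_sum e a b c}"

lemma pyramid_height_eq:
  assumes "s = a - max 0 z" "t = max 0 (- z) / e\<^sup>2" "w = b - max 0 (x - s)" "r = c - max 0 (- x) / e"
    and e: "e > 0"
  shows "pyramid_height e a b c x z =
    (if 0 \<le> s \<and> 0 \<le> w \<and> 0 \<le> r \<and> t \<le> w + c then ennreal (s + e * w + min r (c + w - t)) else 0)"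
proof -
  have *: "{y. (x, z, y) \<in> pyramid_sum e a b c} =
    (if 0 \<le> s \<and> 0 \<le> w \<and> 0 \<le> r \<and> t \<le> w + c then {0..s + e * w + min r (c + w - t)} else {})"
    unfolding pyramid_sum_iff[OF assms(1-4)] by auto
  show ?thesis
  proof (cases "0 \<le> s \<and> 0 \<le> w \<and> 0 \<le> r \<and> t \<le> w + c")
    case True
    hence "0 \<le> s + e * w + min r (c + w - t)" using e by simp
    thus ?thesis unfolding pyramid_height_def * if_P[OF True] by simp
  next
    case False
    show ?thesis unfolding pyramid_height_def * if_not_P[OF False] by simp
  qed
qed

lemma pyramid_height_measurable:
  assumes e: "e > 0" and [measurable]: "f \<in> borel_measurable N" "g \<in> borel_measurable N"
  shows "(\<lambda>p. pyramid_height e a b c (f p) (g p)) \<in> borel_measurable N"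
proof -
  let ?M = "pyramid_sum e a b c"
  define \<iota> :: "'a \<times> real \<Rightarrow> real \<times> real \<times> real" where "\<iota> q = (f (fst q), g (fst q), snd q)" for q
  have "\<iota> \<in> N \<Otimes>\<^sub>M lborel \<rightarrow>\<^sub>M borel \<Otimes>\<^sub>M (borel \<Otimes>\<^sub>M borel)" unfolding \<iota>_def by measurable
  hence "\<iota> \<in> N \<Otimes>\<^sub>M lborel \<rightarrow>\<^sub>M borel" by (simp only: borel_prod)
  hence Q: "\<iota> -` ?M \<inter> space (N \<Otimes>\<^sub>M lborel) \<in> sets (N \<Otimes>\<^sub>M lborel)"
    using pyramid_sum_borel[OF e] by (rule measurable_sets)
  have "(\<lambda>p. emeasure lborel (Pair p -` (\<iota> -` ?M \<inter> space (N \<Otimes>\<^sub>M lborel)))) \<in> borel_measurable N"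
    by (rule lborel.measurable_emeasure_Pair[OF Q])
  moreover have "pyramid_height e a b c (f p) (g p)
      = emeasure lborel (Pair p -` (\<iota> -` ?M \<inter> space (N \<Otimes>\<^sub>M lborel)))" if "p \<in> space N" for p
    unfolding pyramid_height_def using that by (auto simp: \<iota>_def space_pair_measure intro!: arg_cong[where f = "emeasure lborel"])
  ultimately show ?thesis by (simp cong: measurable_cong)
qed

text \<open>Above $z = 0$ the profile in $x$ is simple for fixed $z$; below it the dependence on $z$ is simple for
fixed $x$. Hence the two halves are integrated in different orders.\<close>

lemma emeasure_pyramid_sum_Fubini:
  assumes e: "e > 0"
  shows "emeasure lborel (pyramid_sum e a b c) =
    (\<integral>\<^sup>+z. (\<integral>\<^sup>+x. pyramid_height e a b c x z * indicator {0..} z \<partial>lborel) \<partial>lborel)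
      + (\<integral>\<^sup>+x. (\<integral>\<^sup>+z. pyramid_height e a b c x z * indicator {..0} z \<partial>lborel) \<partial>lborel)"
proof -
  let ?M = "pyramid_sum e a b c" and ?h = "pyramid_height e a b c"
  note pyramid_height_measurable[OF e, measurable (raw)]
  have M: "?M \<in> sets borel" by (rule pyramid_sum_borel[OF e])
  have "emeasure lborel ?M = emeasure (lborel \<Otimes>\<^sub>M lborel) ?M" by (simp only: lborel_prod)
  also have "\<dots> = (\<integral>\<^sup>+x. emeasure lborel (Pair x -` ?M) \<partial>lborel)"
    by (rule lborel.emeasure_pair_measure_alt) (use M in \<open>simp only: lborel_prod sets_lborel\<close>)
  also have "\<dots> = (\<integral>\<^sup>+x. (\<integral>\<^sup>+z. ?h x z \<partial>lborel) \<partial>lborel)"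
  proof (rule nn_integral_cong)
    fix x
    have "?M \<in> sets (borel \<Otimes>\<^sub>M borel)" using M by (simp only: borel_prod)
    hence m: "Pair x -` ?M \<in> sets borel" by (rule sets_Pair1)
    have "emeasure lborel (Pair x -` ?M) = emeasure (lborel \<Otimes>\<^sub>M lborel) (Pair x -` ?M)"
      by (simp only: lborel_prod)
    also have "\<dots> = (\<integral>\<^sup>+z. emeasure lborel (Pair z -` (Pair x -` ?M)) \<partial>lborel)"
      by (rule lborel.emeasure_pair_measure_alt) (use m in \<open>simp only: lborel_prod sets_lborel\<close>)
    also have "\<dots> = (\<integral>\<^sup>+z. ?h x z \<partial>lborel)"
      unfolding pyramid_height_def vimage_def by simp
    finally show "emeasure lborel (Pair x -` ?M) = (\<integral>\<^sup>+z. ?h x z \<partial>lborel)" .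
  qed
  also have "\<dots> = (\<integral>\<^sup>+x. (\<integral>\<^sup>+z. ?h x z * indicator {0..} z \<partial>lborel) + (\<integral>\<^sup>+z. ?h x z * indicator {..0} z \<partial>lborel) \<partial>lborel)"
  proof (rule nn_integral_cong)
    fix x
    have "(\<lambda>z. ?h x z) \<in> borel_measurable borel" by measurable
    thus "(\<integral>\<^sup>+z. ?h x z \<partial>lborel) = (\<integral>\<^sup>+z. ?h x z * indicator {0..} z \<partial>lborel) + (\<integral>\<^sup>+z. ?h x z * indicator {..0} z \<partial>lborel)"
      by (subst nn_integral_split_at[of _ 0]) (simp_all only: add.commute)
  qed
  also have "\<dots> = (\<integral>\<^sup>+x. (\<integral>\<^sup>+z. ?h x z * indicator {0..} z \<partial>lborel) \<partial>lborel)
      + (\<integral>\<^sup>+x. (\<integral>\<^sup>+z. ?h x z * indicator {..0} z \<partial>lborel) \<partial>lborel)"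
    by (rule nn_integral_add) measurable
  also have "(\<integral>\<^sup>+x. (\<integral>\<^sup>+z. ?h x z * indicator {0..} z \<partial>lborel) \<partial>lborel)
      = (\<integral>\<^sup>+z. (\<integral>\<^sup>+x. ?h x z * indicator {0..} z \<partial>lborel) \<partial>lborel)"
    by (rule lborel_pair.Fubini'[symmetric]) measurable
  finally show ?thesis .
qed

text \<open>At height $z$ the section is the sum of a square of side $s = a - z$ and the two triangles in which the other
pyramids meet the plane $z = 0$; its area is a quadratic polynomial in $s$.\<close>

lemma upper_pyramid_sum_volume:
  assumes abc: "0 \<le> a" "0 \<le> b" "0 \<le> c" and e: "e > 0"
  shows "(\<integral>\<^sup>+z. (\<integral>\<^sup>+x. pyramid_height e a b c x z * indicator {0..} z \<partial>lborel) \<partial>lborel)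
    = ennreal (a^3 / 3 + (b + c + e * b + e * c) * a\<^sup>2 / 2 + (b * c + e * b\<^sup>2 / 2 + e * c\<^sup>2 / 2 + e\<^sup>2 * b * c) * a)"
proof -
  let ?h = "pyramid_height e a b c"
  define area where "area s = s\<^sup>2 + (b + c + e * b + e * c) * s + (b * c + e * b\<^sup>2 / 2 + e * c\<^sup>2 / 2 + e\<^sup>2 * b * c)" for s
  have "(\<integral>\<^sup>+z. (\<integral>\<^sup>+x. ?h x z * indicator {0..} z \<partial>lborel) \<partial>lborel)
      = (\<integral>\<^sup>+z. ennreal (area (a - z)) * indicator {0..a} z \<partial>lborel)"
  proof (rule nn_integral_cong)
    fix z :: real
    show "(\<integral>\<^sup>+x. ?h x z * indicator {0..} z \<partial>lborel) = ennreal (area (a - z)) * indicator {0..a} z"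
    proof (cases "0 \<le> z \<and> z \<le> a")
      case False
      have "?h x z * indicator {0..} z = 0" for x
      proof (cases "0 \<le> z")
        case True
        hence "\<not> 0 \<le> a - max 0 z" using False by simp
        thus ?thesis unfolding pyramid_height_eq[OF refl refl refl refl e] by (simp only: if_False simp_thms) simp
      qed simp
      hence "(\<integral>\<^sup>+x. ?h x z * indicator {0..} z \<partial>lborel) = 0" by (simp only: nn_integral_const) simp
      thus ?thesis using False by simp
    next
      case True
      define s where "s = a - z"
      have s: "0 \<le> s" "s = a - max 0 z" using True by (auto simp: s_def)
      have t: "(0::real) = max 0 (- z) / e\<^sup>2" using True by simp
      have hx: "?h x z * indicator {0..} z =
        ennreal (s + e * (b - max 0 (x - s)) + 1 * (c - max 0 (- x) / e)
          + 0 * (b - max 0 (x - s))\<^sup>2 + 0 * (c - max 0 (- x) / e)\<^sup>2 + 0 * (b - max 0 (x - s)) * (c - max 0 (- x) / e))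
        * indicator {- (e * c)..s + b} x" for x
      proof -
        define w where "w = b - max 0 (x - s)"
        define r where "r = c - max 0 (- x) / e"
        have w: "0 \<le> w \<longleftrightarrow> x \<le> s + b" using abc by (auto simp: w_def)
        have r: "0 \<le> r \<longleftrightarrow> - (e * c) \<le> x" using abc e
          by (auto simp: r_def pos_divide_le_eq mult.commute)
        have rc: "r \<le> c" using e by (simp add: r_def)
        have ind: "(indicator {- (e * c)..s + b} x :: ennreal) = (if 0 \<le> w \<and> 0 \<le> r then 1 else 0)"
          unfolding w r indicator_def by auto
        have "?h x z = (if 0 \<le> w \<and> 0 \<le> r then ennreal (s + e * w + r) else 0)"
        proof (cases "0 \<le> w \<and> 0 \<le> r")
          case T: True
          hence "min r (c + w - 0) = r" using rc by simp
          thus ?thesis unfolding pyramid_height_eq[OF s(2) t w_def r_def e] using T s(1) abc by simp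
        next
          case F: False
          thus ?thesis unfolding pyramid_height_eq[OF s(2) t w_def r_def e] by auto
        qed
        thus ?thesis unfolding w_def[symmetric] r_def[symmetric] ind using True by simp
      qed
      have "(\<integral>\<^sup>+x. ?h x z * indicator {0..} z \<partial>lborel) = ennreal (
         e * ((s + e * b + 0 * b\<^sup>2) * c + (1 + 0 * b) * c\<^sup>2 / 2 + 0 * c^3 / 3)
         + s * (s + e * b + 1 * c + 0 * b\<^sup>2 + 0 * c\<^sup>2 + 0 * b * c)
         + ((s + 1 * c + 0 * c\<^sup>2) * b + (e + 0 * c) * b\<^sup>2 / 2 + 0 * b^3 / 3))"
        unfolding hx by (rule nn_integral_broken_profile[OF s(1) abc(2,3) e]) (use s e in simp)
      also have "\<dots> = ennreal (area s)"
        by (rule arg_cong[where f = ennreal]) (simp add: area_def algebra_simps power2_eq_square)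
      finally show ?thesis using True by (simp add: s_def)
    qed
  qed
  also have "\<dots> = ennreal (a^3 / 3 + (b + c + e * b + e * c) * a\<^sup>2 / 2 + (b * c + e * b\<^sup>2 / 2 + e * c\<^sup>2 / 2 + e\<^sup>2 * b * c) * a)"
  proof -
    let ?B = "b + c + e * b + e * c" and ?C = "b * c + e * b\<^sup>2 / 2 + e * c\<^sup>2 / 2 + e\<^sup>2 * b * c"
    let ?F = "\<lambda>z. - ((a - z)^3 / 3 + ?B * (a - z)\<^sup>2 / 2 + ?C * (a - z))"
    have "(\<integral>\<^sup>+z. ennreal (area (a - z)) * indicator {0..a} z \<partial>lborel) = ennreal (?F a - ?F 0)"
    proof (rule nn_integral_FTC_cong[where f = "\<lambda>z. area (a - z)"])
      fix z show "(?F has_real_derivative area (a - z)) (at z)"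
        unfolding area_def by (rule derivative_eq_intros refl | simp add: field_simps power2_eq_square)+
    next
      fix z assume "0 \<le> z" "z \<le> a"
      thus "0 \<le> area (a - z)" using abc e by (simp add: area_def)
    qed (use abc in \<open>auto simp: area_def\<close>)
    also have "?F a - ?F 0 = a^3 / 3 + ?B * a\<^sup>2 / 2 + ?C * a" by simp
    finally show ?thesis .
  qed
  finally show ?thesis .
qed

text \<open>Below $z = 0$ the first pyramid contributes its full base, so $s = a$; the area of the section at a
fixed $x$ is $\varepsilon^2 ((a + \varepsilon w)(w + c) + r (w + c) - r^2/2)$.\<close>

lemma lower_pyramid_sum_volume:
  assumes abc: "0 \<le> a" "0 \<le> b" "0 \<le> c" and e: "e > 0"
  shows "(\<integral>\<^sup>+x. (\<integral>\<^sup>+z. pyramid_height e a b c x z * indicator {..0} z \<partial>lborel) \<partial>lborel)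
    = ennreal (e\<^sup>2 * (e * ((a + e * b) * (b + c) * c + (b + c) * c\<^sup>2 / 2 - c^3 / 6)
        + a * ((a + e * b) * (b + c) + (b + c) * c - c\<^sup>2 / 2)
        + (a * (c * b + b\<^sup>2 / 2) + e * (c * b\<^sup>2 / 2 + b^3 / 3) + c * b\<^sup>2 / 2 + c\<^sup>2 * b / 2)))"
proof -
  let ?h = "pyramid_height e a b c"
  have "(\<integral>\<^sup>+x. (\<integral>\<^sup>+z. ?h x z * indicator {..0} z \<partial>lborel) \<partial>lborel) =
     (\<integral>\<^sup>+x. ennreal (e\<^sup>2 * (a * c) + e\<^sup>2 * (a + e * c) * (b - max 0 (x - a)) + e\<^sup>2 * c * (c - max 0 (- x) / e)
          + e\<^sup>2 * e * (b - max 0 (x - a))\<^sup>2 + - (e\<^sup>2 / 2) * (c - max 0 (- x) / e)\<^sup>2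
          + e\<^sup>2 * (b - max 0 (x - a)) * (c - max 0 (- x) / e))
        * indicator {- (e * c)..a + b} x \<partial>lborel)"
  proof (rule nn_integral_cong)
    fix x :: real
    define w where "w = b - max 0 (x - a)"
    define r where "r = c - max 0 (- x) / e"
    have w: "0 \<le> w \<longleftrightarrow> x \<le> a + b" using abc by (auto simp: w_def)
    have r: "0 \<le> r \<longleftrightarrow> - (e * c) \<le> x" using abc e
      by (auto simp: r_def pos_divide_le_eq mult.commute)
    have rc: "r \<le> c" using e by (simp add: r_def)
    have hz: "?h x z * indicator {..0} z =
       (if 0 \<le> w \<and> 0 \<le> r then ennreal ((a + e * w) + min r ((w + c) - max 0 (- z) / e\<^sup>2)) * indicator {- (e\<^sup>2 * (w + c))..0} z else 0)" for z
    proof (cases "z \<le> 0")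
      case True
      define t where "t = max 0 (- z) / e\<^sup>2"
      have a: "a = a - max 0 z" using True by simp
      have "t = - z / e\<^sup>2" using True by (simp add: t_def)
      hence "t \<le> w + c \<longleftrightarrow> - z \<le> (w + c) * e\<^sup>2" using e by (simp only: pos_divide_le_eq zero_less_power)
      hence t: "t \<le> w + c \<longleftrightarrow> - (e\<^sup>2 * (w + c)) \<le> z" unfolding mult.commute[of "e\<^sup>2"] by linarith
      have ind: "(indicator {- (e\<^sup>2 * (w + c))..0} z :: ennreal) = (if t \<le> w + c then 1 else 0)"
        using True unfolding t indicator_def by auto
      have "?h x z = (if 0 \<le> w \<and> 0 \<le> r \<and> t \<le> w + c then ennreal (a + e * w + min r (w + c - t)) else 0)"
        using abc(1) unfolding pyramid_height_eq[OF a t_def w_def r_def e] add.commute[of c w] by (simp only: simp_thms)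
      thus ?thesis unfolding t_def[symmetric] ind using True by simp
    qed auto
    show "(\<integral>\<^sup>+z. ?h x z * indicator {..0} z \<partial>lborel) =
        ennreal (e\<^sup>2 * (a * c) + e\<^sup>2 * (a + e * c) * (b - max 0 (x - a)) + e\<^sup>2 * c * (c - max 0 (- x) / e)
          + e\<^sup>2 * e * (b - max 0 (x - a))\<^sup>2 + - (e\<^sup>2 / 2) * (c - max 0 (- x) / e)\<^sup>2
          + e\<^sup>2 * (b - max 0 (x - a)) * (c - max 0 (- x) / e))
        * indicator {- (e * c)..a + b} x"
    proof (cases "0 \<le> w \<and> 0 \<le> r")
      case True
      have "(\<integral>\<^sup>+z. ?h x z * indicator {..0} z \<partial>lborel)
        = (\<integral>\<^sup>+z. ennreal ((a + e * w) + min r ((w + c) - max 0 (- z) / e\<^sup>2)) * indicator {- (e\<^sup>2 * (w + c))..0} z \<partial>lborel)"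
        unfolding hz using True by simp
      also have "\<dots> = ennreal (e\<^sup>2 * ((a + e * w) * (w + c) + r * (w + c) - r\<^sup>2 / 2))"
        using True abc e rc by (intro nn_integral_truncated_ramp) auto
      also have "e\<^sup>2 * ((a + e * w) * (w + c) + r * (w + c) - r\<^sup>2 / 2) =
         e\<^sup>2 * (a * c) + e\<^sup>2 * (a + e * c) * w + e\<^sup>2 * c * r + e\<^sup>2 * e * w\<^sup>2 + - (e\<^sup>2 / 2) * r\<^sup>2 + e\<^sup>2 * w * r"
        by (simp add: algebra_simps power2_eq_square)
      finally have "(\<integral>\<^sup>+z. ?h x z * indicator {..0} z \<partial>lborel) =
        ennreal (e\<^sup>2 * (a * c) + e\<^sup>2 * (a + e * c) * w + e\<^sup>2 * c * r + e\<^sup>2 * e * w\<^sup>2 + - (e\<^sup>2 / 2) * r\<^sup>2 + e\<^sup>2 * w * r)" .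
      moreover have "(indicator {- (e * c)..a + b} x :: ennreal) = 1"
        using True unfolding w r indicator_def by auto
      ultimately show ?thesis unfolding w_def[symmetric] r_def[symmetric] by (simp only: mult_1_right)
    next
      case False
      have "?h x z * indicator {..0} z = 0" for z unfolding hz if_not_P[OF False] ..
      hence "(\<integral>\<^sup>+z. ?h x z * indicator {..0} z \<partial>lborel) = 0" by (simp only: nn_integral_const) simp
      moreover have "(indicator {- (e * c)..a + b} x :: ennreal) = 0"
        using False unfolding w r indicator_def by auto
      ultimately show ?thesis by (simp only: mult_zero_right)
    qed
  qed
  also have "\<dots> = ennreal (
      e * ((e\<^sup>2 * (a * c) + e\<^sup>2 * (a + e * c) * b + e\<^sup>2 * e * b\<^sup>2) * c + (e\<^sup>2 * c + e\<^sup>2 * b) * c\<^sup>2 / 2 + - (e\<^sup>2 / 2) * c^3 / 3)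
      + a * (e\<^sup>2 * (a * c) + e\<^sup>2 * (a + e * c) * b + e\<^sup>2 * c * c + e\<^sup>2 * e * b\<^sup>2 + - (e\<^sup>2 / 2) * c\<^sup>2 + e\<^sup>2 * b * c)
      + ((e\<^sup>2 * (a * c) + e\<^sup>2 * c * c + - (e\<^sup>2 / 2) * c\<^sup>2) * b + (e\<^sup>2 * (a + e * c) + e\<^sup>2 * c) * b\<^sup>2 / 2 + e\<^sup>2 * e * b^3 / 3))"
  proof (rule nn_integral_broken_profile[OF abc(1,2,3) e])
    fix w r assume wr: "0 \<le> w" "w \<le> b" "0 \<le> r" "r \<le> c"
    have "r * r \<le> c * r" using wr by (intro mult_right_mono) auto
    hence "r\<^sup>2 / 2 \<le> c * r" using zero_le_square[of r] unfolding power2_eq_square by linarith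
    hence "0 \<le> e\<^sup>2 * ((a + e * w) * (w + c) + r * w + (c * r - r\<^sup>2 / 2))"
      using wr abc e by (intro mult_nonneg_nonneg add_nonneg_nonneg) auto
    also have "\<dots> = e\<^sup>2 * (a * c) + e\<^sup>2 * (a + e * c) * w + e\<^sup>2 * c * r + e\<^sup>2 * e * w\<^sup>2 + - (e\<^sup>2 / 2) * r\<^sup>2 + e\<^sup>2 * w * r"
      by (simp add: algebra_simps power2_eq_square)
    finally show "0 \<le> \<dots>" .
  qed
  also have "(e * ((e\<^sup>2 * (a * c) + e\<^sup>2 * (a + e * c) * b + e\<^sup>2 * e * b\<^sup>2) * c + (e\<^sup>2 * c + e\<^sup>2 * b) * c\<^sup>2 / 2 + - (e\<^sup>2 / 2) * c^3 / 3)
      + a * (e\<^sup>2 * (a * c) + e\<^sup>2 * (a + e * c) * b + e\<^sup>2 * c * c + e\<^sup>2 * e * b\<^sup>2 + - (e\<^sup>2 / 2) * c\<^sup>2 + e\<^sup>2 * b * c)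
      + ((e\<^sup>2 * (a * c) + e\<^sup>2 * c * c + - (e\<^sup>2 / 2) * c\<^sup>2) * b + (e\<^sup>2 * (a + e * c) + e\<^sup>2 * c) * b\<^sup>2 / 2 + e\<^sup>2 * e * b^3 / 3))
    = e\<^sup>2 * (e * ((a + e * b) * (b + c) * c + (b + c) * c\<^sup>2 / 2 - c^3 / 6)
        + a * ((a + e * b) * (b + c) + (b + c) * c - c\<^sup>2 / 2)
        + (a * (c * b + b\<^sup>2 / 2) + e * (c * b\<^sup>2 / 2 + b^3 / 3) + c * b\<^sup>2 / 2 + c\<^sup>2 * b / 2))" (is "?L = ?R")
    by (simp add: field_simps power2_eq_square power3_eq_cube)
  finally show ?thesis .
qed

lemma emeasure_pyramid_sum:
  assumes abc: "0 \<le> a" "0 \<le> b" "0 \<le> c" and e: "e > 0"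
  shows "emeasure lborel (pyramid_sum e a b c) = ennreal (
     (a^3 / 3 + (b + c + e * b + e * c) * a\<^sup>2 / 2 + (b * c + e * b\<^sup>2 / 2 + e * c\<^sup>2 / 2 + e\<^sup>2 * b * c) * a)
     + e\<^sup>2 * (e * ((a + e * b) * (b + c) * c + (b + c) * c\<^sup>2 / 2 - c^3 / 6)
        + a * ((a + e * b) * (b + c) + (b + c) * c - c\<^sup>2 / 2)
        + (a * (c * b + b\<^sup>2 / 2) + e * (c * b\<^sup>2 / 2 + b^3 / 3) + c * b\<^sup>2 / 2 + c\<^sup>2 * b / 2)))" (is "_ = ennreal (?U + ?L)")
proof -
  have "0 \<le> ?U" using abc e by simp
  moreover have "0 \<le> ?L"
  proof -
    have "?L = e\<^sup>2 * (e * ((a + e * b) * (b + c) * c + b * c\<^sup>2 / 2 + c^3 / 3)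
        + a * ((a + e * b) * (b + c) + b * c + c\<^sup>2 / 2)
        + (a * (c * b + b\<^sup>2 / 2) + e * (c * b\<^sup>2 / 2 + b^3 / 3) + c * b\<^sup>2 / 2 + c\<^sup>2 * b / 2))"
      by (simp add: field_simps power2_eq_square power3_eq_cube)
    also have "0 \<le> \<dots>" using abc e by simp
    finally show ?thesis .
  qed
  ultimately show ?thesis
    unfolding emeasure_pyramid_sum_Fubini[OF e] upper_pyramid_sum_volume[OF abc e] lower_pyramid_sum_volume[OF abc e]
    by (rule ennreal_plus[symmetric])
qed

section \<open>The extremal family\<close>

lemma pyramid1_halfspaces:
  "pyramid1 = {p. inner (-1, 0, 0) p \<le> 0} \<inter> {p. inner (0, -1, 0) p \<le> 0} \<inter> {p. inner (0, 0, -1) p \<le> 0}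
     \<inter> {p. inner (1, 1, 0) p \<le> 1} \<inter> {p. inner (0, 1, 1) p \<le> 1}"
  by (auto simp: pyramid1_def inner_prod_def)

lemma pyramid2_halfspaces:
  "pyramid2 e = {p. inner (-1, 0, 0) p \<le> 0} \<inter> {p. inner (0, 1, 0) p \<le> 0} \<inter> {p. inner (0, 0, -1) p \<le> 0}
     \<inter> {p. inner (e, 0, 1) p \<le> e} \<inter> {p. inner (e\<^sup>2, -1, 0) p \<le> e\<^sup>2}"
  by (auto simp: pyramid2_def inner_prod_def algebra_simps)

lemma pyramid3_halfspaces:
  "pyramid3 e = {p. inner (1, 0, 0) p \<le> 0} \<inter> {p. inner (0, 1, 0) p \<le> 0} \<inter> {p. inner (0, 0, -1) p \<le> 0}
     \<inter> {p. inner (-1, 0, e) p \<le> e} \<inter> {p. inner (0, -1, e\<^sup>2) p \<le> e\<^sup>2}"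
  by (auto simp: pyramid3_def inner_prod_def algebra_simps)

lemma compact_closed_subset:
  fixes S T :: "'a::t2_space set"
  assumes "compact T" "S \<subseteq> T" "closed S"
  shows "compact S"
  using compact_Int_closed[OF assms(1,3)] Int_absorb1[OF assms(2)] by simp

lemma compact_pyramid1: "compact pyramid1"
proof -
  have "pyramid1 \<subseteq> {0..1} \<times> {0..1} \<times> {0..1}" by (auto simp: pyramid1_def)
  moreover have "closed pyramid1"
    unfolding pyramid1_halfspaces by (intro closed_Int closed_halfspace_le)
  ultimately show ?thesis
    by (rule compact_closed_subset[OF compact_Times[OF compact_Icc compact_Times[OF compact_Icc compact_Icc]]])
qed

lemma compact_pyramid2: assumes "e > 0" shows "compact (pyramid2 e)"
proof -
  have "pyramid2 e \<subseteq> {0..1} \<times> {- (e\<^sup>2)..0} \<times> {0..e}"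
  proof (clarsimp simp: pyramid2_def)
    fix x z y assume *: "0 \<le> x" "z \<le> 0" "0 \<le> y" "y \<le> e * (1 - x)" "- z \<le> e\<^sup>2 * (1 - x)"
    have "0 \<le> e * (1 - x)" using * by linarith
    hence "x \<le> 1" using assms by (simp add: zero_le_mult_iff)
    moreover have "e * (1 - x) \<le> e" "e\<^sup>2 * (1 - x) \<le> e\<^sup>2"
      using * assms by (auto intro: mult_left_le)
    ultimately show "x \<le> 1 \<and> - (e\<^sup>2) \<le> z \<and> y \<le> e" using * by linarith
  qed
  moreover have "closed (pyramid2 e)"
    unfolding pyramid2_halfspaces by (intro closed_Int closed_halfspace_le)
  ultimately show ?thesis
    by (rule compact_closed_subset[OF compact_Times[OF compact_Icc compact_Times[OF compact_Icc compact_Icc]]])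
qed

lemma compact_pyramid3: assumes "e > 0" shows "compact (pyramid3 e)"
proof -
  have "pyramid3 e \<subseteq> {- e..0} \<times> {- (e\<^sup>2)..0} \<times> {0..1}"
  proof (clarsimp simp: pyramid3_def)
    fix x z y assume *: "x \<le> 0" "z \<le> 0" "0 \<le> y" "- x \<le> e * (1 - y)" "- z \<le> e\<^sup>2 * (1 - y)"
    have "0 \<le> e * (1 - y)" using * by linarith
    hence "y \<le> 1" using assms by (simp add: zero_le_mult_iff)
    moreover have "e * (1 - y) \<le> e" "e\<^sup>2 * (1 - y) \<le> e\<^sup>2"
      using * assms by (auto intro: mult_left_le)
    ultimately show "- e \<le> x \<and> - (e\<^sup>2) \<le> z \<and> y \<le> 1" using * by linarith
  qed
  moreover have "closed (pyramid3 e)"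
    unfolding pyramid3_halfspaces by (intro closed_Int closed_halfspace_le)
  ultimately show ?thesis
    by (rule compact_closed_subset[OF compact_Times[OF compact_Icc compact_Times[OF compact_Icc compact_Icc]]])
qed

lemma convex_body_vec3_image:
  assumes "S \<noteq> {}" "compact S" "convex S"
  shows "convex_body (vec3 ` S)"
  unfolding convex_body_def
  using assms(1) compact_continuous_image[OF continuous_on_vec3 assms(2)]
    convex_linear_image[OF linear_vec3 assms(3)]
  by blast

lemma convex_body_pyramids:
  assumes e: "e > 0"
  shows "convex_body (vec3 ` pyramid1)" "convex_body (vec3 ` pyramid2 e)" "convex_body (vec3 ` pyramid3 e)"
proof -
  have "(0, 0, 0) \<in> pyramid1" "(0, 0, 0) \<in> pyramid2 e" "(0, 0, 0) \<in> pyramid3 e"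
    using e by (auto simp: pyramid1_def pyramid2_def pyramid3_def)
  hence ne: "pyramid1 \<noteq> {}" "pyramid2 e \<noteq> {}" "pyramid3 e \<noteq> {}" by blast+
  have cv: "convex pyramid1" "convex (pyramid2 e)" "convex (pyramid3 e)"
    unfolding pyramid1_halfspaces pyramid2_halfspaces pyramid3_halfspaces
    by (intro convex_Int convex_halfspace_le)+
  show "convex_body (vec3 ` pyramid1)" "convex_body (vec3 ` pyramid2 e)" "convex_body (vec3 ` pyramid3 e)"
    by (rule convex_body_vec3_image[OF ne(1) compact_pyramid1 cv(1)]
        convex_body_vec3_image[OF ne(2) compact_pyramid2[OF e] cv(2)]
        convex_body_vec3_image[OF ne(3) compact_pyramid3[OF e] cv(3)])+
qed

text \<open>Six times the mixed volumes of the three pyramids. Up to powers of $\varepsilon$, all mixed volumes of exactly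
two different bodies agree.\<close>

definition pyramid_cubic :: "real \<Rightarrow> cubic" where
  "pyramid_cubic e \<alpha> =
     (let q = 1 + e + 2 * e\<^sup>2 in
      if \<alpha> = (3,0,0) then 2
      else if \<alpha> = (0,3,0) \<or> \<alpha> = (0,0,3) then 2 * e^3
      else if \<alpha> = (2,1,0) \<or> \<alpha> = (2,0,1) then q
      else if \<alpha> = (1,2,0) \<or> \<alpha> = (1,0,2) then e * q
      else if \<alpha> = (0,2,1) \<or> \<alpha> = (0,1,2) then e\<^sup>2 * q
      else 1 + 3 * e\<^sup>2 + 2 * e^3)"

lemma pyramid_cubic_simps:
  "pyramid_cubic e (3,0,0) = 2" "pyramid_cubic e (0,3,0) = 2 * e^3" "pyramid_cubic e (0,0,3) = 2 * e^3"
  "pyramid_cubic e (2,1,0) = 1 + e + 2 * e\<^sup>2" "pyramid_cubic e (2,0,1) = 1 + e + 2 * e\<^sup>2"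
  "pyramid_cubic e (1,2,0) = e * (1 + e + 2 * e\<^sup>2)" "pyramid_cubic e (1,0,2) = e * (1 + e + 2 * e\<^sup>2)"
  "pyramid_cubic e (0,2,1) = e\<^sup>2 * (1 + e + 2 * e\<^sup>2)" "pyramid_cubic e (0,1,2) = e\<^sup>2 * (1 + e + 2 * e\<^sup>2)"
  "pyramid_cubic e (1,1,1) = 1 + 3 * e\<^sup>2 + 2 * e^3"
  by (simp_all add: pyramid_cubic_def Let_def)

lemma full_support_pyramid_cubic:
  assumes "e > 0" shows "full_support (pyramid_cubic e)"
  unfolding full_support_def Delta33_eq ball_simps pyramid_cubic_simps using assms by (simp add: add_pos_pos)

lemma cubic_eval_pyramid_cubic:
  "cubic_eval (pyramid_cubic e) a b c =
     (a^3 / 3 + (b + c + e * b + e * c) * a\<^sup>2 / 2 + (b * c + e * b\<^sup>2 / 2 + e * c\<^sup>2 / 2 + e\<^sup>2 * b * c) * a)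
     + e\<^sup>2 * (e * ((a + e * b) * (b + c) * c + (b + c) * c\<^sup>2 / 2 - c^3 / 6)
        + a * ((a + e * b) * (b + c) + (b + c) * c - c\<^sup>2 / 2)
        + (a * (c * b + b\<^sup>2 / 2) + e * (c * b\<^sup>2 / 2 + b^3 / 3) + c * b\<^sup>2 / 2 + c\<^sup>2 * b / 2))"
  unfolding cubic_eval_expand pyramid_cubic_simps
  by (simp add: field_simps power2_eq_square power3_eq_cube)

lemma vec3_image_scaleR: "(*\<^sub>R) a ` vec3 ` S = vec3 ` ((*\<^sub>R) a ` S)"
  by (simp add: image_image vec3_scaleR)

lemma vec3_image_plus: "vec3 ` S + vec3 ` T = vec3 ` (S + T)"
proof (intro equalityI subsetI)
  fix v assume "v \<in> vec3 ` S + vec3 ` T"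
  then obtain p q where "p \<in> S" "q \<in> T" and v: "v = vec3 p + vec3 q" by (auto elim!: set_plus_elim)
  thus "v \<in> vec3 ` (S + T)" unfolding v vec3_add[symmetric] by (intro imageI set_plus_intro)
next
  fix v assume "v \<in> vec3 ` (S + T)"
  then obtain p q where "p \<in> S" "q \<in> T" and v: "v = vec3 (p + q)" by (auto elim!: set_plus_elim)
  thus "v \<in> vec3 ` S + vec3 ` T" unfolding v vec3_add by (intro imageI set_plus_intro)
qed

lemma is_volume_polynomial_pyramid_cubic:
  assumes e: "e > 0"
  shows "is_volume_polynomial (pyramid_cubic e) (vec3 ` pyramid1) (vec3 ` pyramid2 e) (vec3 ` pyramid3 e)"
  unfolding is_volume_polynomial_def
proof (intro allI impI)
  fix a b c :: real assume abc: "0 \<le> a" "0 \<le> b" "0 \<le> c"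
  let ?P = "pyramid_sum e a b c"
  have sum: "(*\<^sub>R) a ` vec3 ` pyramid1 + (*\<^sub>R) b ` vec3 ` pyramid2 e + (*\<^sub>R) c ` vec3 ` pyramid3 e = vec3 ` ?P"
    unfolding vec3_image_scaleR vec3_image_plus Minkowski_sum_pyramids[OF abc e] ..
  have "compact ?P"
    unfolding Minkowski_sum_pyramids[OF abc e, symmetric]
    by (intro compact_set_plus compact_scaling compact_pyramid1 compact_pyramid2 compact_pyramid3 e)
  hence m: "measure lebesgue (vec3 ` ?P) = measure lborel ?P" by (rule measure_lebesgue_vec3_image)
  have em: "emeasure lborel ?P = ennreal (cubic_eval (pyramid_cubic e) a b c)"
    unfolding cubic_eval_pyramid_cubic by (rule emeasure_pyramid_sum[OF abc e])
  have "0 \<le> cubic_eval (pyramid_cubic e) a b c"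
    unfolding cubic_eval_expand pyramid_cubic_simps using abc e by simp
  hence "measure lborel ?P = cubic_eval (pyramid_cubic e) a b c" by (simp add: measure_def em)
  thus "cubic_eval (pyramid_cubic e) a b c = measure lebesgue
     ((*\<^sub>R) a ` vec3 ` pyramid1 + (*\<^sub>R) b ` vec3 ` pyramid2 e + (*\<^sub>R) c ` vec3 ` pyramid3 e)"
    unfolding sum m by (rule sym)
qed

lemma pyramid_cubic_in_volume_cubics:
  assumes e: "e > 0"
  shows "pyramid_cubic e \<in> volume_cubics"
  unfolding volume_cubics_def mem_Collect_eq
  using full_support_pyramid_cubic[OF e] convex_body_pyramids[OF e]
    is_volume_polynomial_pyramid_cubic[OF e]
  by blast

text \<open>With $q$ and $R$ for the two recurring values, all three slices have the determinant
$2 (R - \varepsilon q)(q^2 - \varepsilon q - R)$ up to a power of $\varepsilon$, and both factors are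
positive.\<close>

lemma pyramid_cubic_in_lorentzian_cubics:
  assumes e: "e > 0"
  shows "pyramid_cubic e \<in> lorentzian_cubics"
proof -
  define q where "q = 1 + e + 2 * e\<^sup>2"
  define R where "R = 1 + 3 * e\<^sup>2 + 2 * e^3"
  have p: "0 < 1 - e + 2 * e\<^sup>2"
    using zero_le_power2[of "e - 1/4"] by (simp add: power2_eq_square algebra_simps)
  have q0: "q > 0" using e by (simp add: q_def add_pos_pos)
  have qe: "q - 2 * e > 0" using p by (simp add: q_def)
  have Re: "R - e * q = 1 - e + 2 * e\<^sup>2" by (simp add: R_def q_def algebra_simps power2_eq_square power3_eq_cube)
  have qR: "q\<^sup>2 - e * q - R = e + e\<^sup>2 + 4 * e^4"
    by (simp add: R_def q_def algebra_simps power2_eq_square power3_eq_cube power4_eq_xxxx)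
  have D: "0 \<le> 2 * ((R - e * q) * (q\<^sup>2 - e * q - R))" unfolding Re qR using p e by simp
  have eD: "0 \<le> e^3 * (2 * ((R - e * q) * (q\<^sup>2 - e * q - R)))" using D e by simp
  have "(e * q)\<^sup>2 \<le> R\<^sup>2" using Re p e q0 by (intro power_mono) auto
  hence m3: "(e * q)\<^sup>2 - R\<^sup>2 \<le> 0" by simp
  have m1: "0 \<le> q * (q - 2 * e)" "0 \<le> e\<^sup>2 * (q * (q - 2 * e))" "0 \<le> e^4 * (q * (q - 2 * e))"
    using q0 qe e by (auto intro!: mult_nonneg_nonneg)
  have "num_pos_eigenvalues (cubic_slice (pyramid_cubic e) 0) \<le> 1"
    unfolding cubic_slice_eq pyramid_cubic_simps q_def[symmetric] R_def[symmetric]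
  proof (rule num_pos_eigenvalues_sym3_le_1)
    have "2 * (e * q * (e * q) - R\<^sup>2) - q * (q * (e * q) - q * R) + q * (q * R - q * (e * q))
      = 2 * ((R - e * q) * (q\<^sup>2 - e * q - R))"
      by (simp add: algebra_simps power2_eq_square)
    thus "0 \<le> 2 * (e * q * (e * q) - R\<^sup>2) - q * (q * (e * q) - q * R) + q * (q * R - q * (e * q))" using D by simp
    have "(2 * (e * q) - q\<^sup>2) + (2 * (e * q) - q\<^sup>2) + (e * q * (e * q) - R\<^sup>2) =
      ((e * q)\<^sup>2 - R\<^sup>2) - 2 * (q * (q - 2 * e))" by (simp add: algebra_simps power2_eq_square)
    thus "(2 * (e * q) - q\<^sup>2) + (2 * (e * q) - q\<^sup>2) + (e * q * (e * q) - R\<^sup>2) \<le> 0" using m1 m3 by linarith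
  qed
  moreover have "num_pos_eigenvalues (cubic_slice (pyramid_cubic e) 1) \<le> 1"
    unfolding cubic_slice_eq pyramid_cubic_simps q_def[symmetric] R_def[symmetric]
  proof (rule num_pos_eigenvalues_sym3_le_1)
    have "q * (2 * e^3 * (e\<^sup>2 * q) - (e\<^sup>2 * q)\<^sup>2) - e * q * (e * q * (e\<^sup>2 * q) - R * (e\<^sup>2 * q)) + R * (e * q * (e\<^sup>2 * q) - R * (2 * e^3))
      = e^3 * (2 * ((R - e * q) * (q\<^sup>2 - e * q - R)))"
      by (simp add: algebra_simps power2_eq_square power3_eq_cube)
    thus "0 \<le> q * (2 * e^3 * (e\<^sup>2 * q) - (e\<^sup>2 * q)\<^sup>2) - e * q * (e * q * (e\<^sup>2 * q) - R * (e\<^sup>2 * q)) + R * (e * q * (e\<^sup>2 * q) - R * (2 * e^3))"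
      using eD by simp
    have "(q * (2 * e^3) - (e * q)\<^sup>2) + (q * (e\<^sup>2 * q) - R\<^sup>2) + (2 * e^3 * (e\<^sup>2 * q) - (e\<^sup>2 * q)\<^sup>2)
      = ((e * q)\<^sup>2 - R\<^sup>2) - e\<^sup>2 * (q * (q - 2 * e)) - e^4 * (q * (q - 2 * e))"
      by (simp add: algebra_simps power2_eq_square power3_eq_cube power4_eq_xxxx)
    thus "(q * (2 * e^3) - (e * q)\<^sup>2) + (q * (e\<^sup>2 * q) - R\<^sup>2) + (2 * e^3 * (e\<^sup>2 * q) - (e\<^sup>2 * q)\<^sup>2) \<le> 0"
      using m1 m3 by linarith
  qed
  moreover have "num_pos_eigenvalues (cubic_slice (pyramid_cubic e) 2) \<le> 1"
    unfolding cubic_slice_eq pyramid_cubic_simps q_def[symmetric] R_def[symmetric]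
  proof (rule num_pos_eigenvalues_sym3_le_1)
    have "q * (e\<^sup>2 * q * (2 * e^3) - (e\<^sup>2 * q)\<^sup>2) - R * (R * (2 * e^3) - e * q * (e\<^sup>2 * q)) + e * q * (R * (e\<^sup>2 * q) - e * q * (e\<^sup>2 * q))
      = e^3 * (2 * ((R - e * q) * (q\<^sup>2 - e * q - R)))"
      by (simp add: algebra_simps power2_eq_square power3_eq_cube)
    thus "0 \<le> q * (e\<^sup>2 * q * (2 * e^3) - (e\<^sup>2 * q)\<^sup>2) - R * (R * (2 * e^3) - e * q * (e\<^sup>2 * q)) + e * q * (R * (e\<^sup>2 * q) - e * q * (e\<^sup>2 * q))"
      using eD by simp
    have "(q * (e\<^sup>2 * q) - R\<^sup>2) + (q * (2 * e^3) - (e * q)\<^sup>2) + (e\<^sup>2 * q * (2 * e^3) - (e\<^sup>2 * q)\<^sup>2)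
      = ((e * q)\<^sup>2 - R\<^sup>2) - e\<^sup>2 * (q * (q - 2 * e)) - e^4 * (q * (q - 2 * e))"
      by (simp add: algebra_simps power2_eq_square power3_eq_cube power4_eq_xxxx)
    thus "(q * (e\<^sup>2 * q) - R\<^sup>2) + (q * (2 * e^3) - (e * q)\<^sup>2) + (e\<^sup>2 * q * (2 * e^3) - (e\<^sup>2 * q)\<^sup>2) \<le> 0"
      using m1 m3 by linarith
  qed
  ultimately show ?thesis
    using full_support_pyramid_cubic[OF e] unfolding lorentzian_cubics_def
    by (auto simp: less_Suc_eq numeral_3_eq_3 numeral_2_eq_2)
qed

lemma Phi_diag_pyramid_cubic:
  assumes "e > 0"
  shows "Phi_diag (pyramid_cubic e) = 8 * (1 + 3 * e\<^sup>2 + 2 * e^3)^3 / (1 + e + 2 * e\<^sup>2)^6"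
proof -
  define q where "q = 1 + e + 2 * e\<^sup>2"
  define R where "R = 1 + 3 * e\<^sup>2 + 2 * e^3"
  have "q > 0" using assms by (simp add: q_def add_pos_pos)
  moreover have "q * q * (e * q) * (e\<^sup>2 * q) * (e * q) * (e\<^sup>2 * q) = e^6 * q^6"
    "R^3 * 2 * (2 * e^3) * (2 * e^3) = e^6 * (8 * R^3)"
    by (simp_all add: power_def)
  ultimately show ?thesis
    unfolding Phi_diag_def pyramid_cubic_simps q_def[symmetric] R_def[symmetric] using assms by simp
qed

lemma Phi_diag_pyramid_cubic_limit:
  "((\<lambda>e. ereal (Phi_diag (pyramid_cubic e))) \<longlongrightarrow> 8) (at_right 0)"
proof -
  have "((\<lambda>e::real. 8 * (1 + 3 * e\<^sup>2 + 2 * e^3)^3 / (1 + e + 2 * e\<^sup>2)^6)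
      \<longlongrightarrow> 8 * (1 + 3 * 0\<^sup>2 + 2 * 0^3)^3 / (1 + 0 + 2 * 0\<^sup>2)^6) (at_right 0)"
    by (intro tendsto_intros) simp
  hence "((\<lambda>e::real. 8 * (1 + 3 * e\<^sup>2 + 2 * e^3)^3 / (1 + e + 2 * e\<^sup>2)^6) \<longlongrightarrow> 8) (at_right 0)" by simp
  hence "((\<lambda>e. Phi_diag (pyramid_cubic e)) \<longlongrightarrow> 8) (at_right 0)"
    by (rule Lim_transform_eventually)
       (auto simp: eventually_at_filter Phi_diag_pyramid_cubic)
  hence "((\<lambda>e. ereal (Phi_diag (pyramid_cubic e))) \<longlongrightarrow> ereal 8) (at_right 0)"
    by (intro tendsto_intros)
  thus ?thesis by simp
qed

text \<open>The lower estimate is the limit of $8 r^3 / q^6$ as $\varepsilon$ tends to 0.\<close>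

lemma SUP_Phi_diag_eq_8:
  assumes le: "\<And>c. c \<in> A \<Longrightarrow> Phi_diag c \<le> 8"
    and mem: "\<And>e. e > 0 \<Longrightarrow> pyramid_cubic e \<in> A"
  shows "(SUP c\<in>A. ereal (Phi_diag c)) = 8"
proof (rule antisym)
  show "(SUP c\<in>A. ereal (Phi_diag c)) \<le> 8"
  proof (rule SUP_least)
    fix c assume "c \<in> A"
    hence "ereal (Phi_diag c) \<le> ereal 8" using le by simp
    thus "ereal (Phi_diag c) \<le> 8" by simp
  qed
  show "8 \<le> (SUP c\<in>A. ereal (Phi_diag c))"
  proof (rule tendsto_upperbound[OF Phi_diag_pyramid_cubic_limit])
    show "\<forall>\<^sub>F e in at_right 0. ereal (Phi_diag (pyramid_cubic e)) \<le> (SUP c\<in>A. ereal (Phi_diag c))"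
      by (rule eventually_mono[OF eventually_at_right_less[of 0]]) (intro SUP_upper mem)
  qed simp
qed

theorem proposition7p1:
  shows "(SUP c\<in>volume_cubics. ereal (Phi_diag c)) = (SUP c\<in>lorentzian_cubics. ereal (Phi_diag c)) \<and>
    (SUP c\<in>lorentzian_cubics. ereal (Phi_diag c)) = 8"
proof -
  have "(SUP c\<in>lorentzian_cubics. ereal (Phi_diag c)) = 8"
    by (intro SUP_Phi_diag_eq_8 lorentzian_Phi_diag_le_8 pyramid_cubic_in_lorentzian_cubics)
  moreover have "(SUP c\<in>volume_cubics. ereal (Phi_diag c)) = 8"
    by (intro SUP_Phi_diag_eq_8 volume_Phi_diag_le_8 pyramid_cubic_in_volume_cubics)
  ultimately show ?thesis by simp
qed

end
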